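(* Let $F$ be a field. Let $R= F\langle a,b\rangle$ be the free $F$-algebra on $a,b$, and let $S = F\langle q,x \mid q=qxq,\ x=xqx \rangle$. Let $I = R(1-ba)$ and let $T$ be the subalgebra of $M_2(R)$ given by $$T = \begin{bmatrix} R & I \\ R & F+I \end{bmatrix},$$ where $F+I$ means $F1+I$. Then there is an isomorphism of $F$-algebras $S \cong T$ under which $$q \mapsto Q = \begin{bmatrix} b & 1-ba \\ 0 & 0\end{bmatrix}\quad\text{and}\quad x\mapsto X = \begin{bmatrix} a & 0\\ 1 & 0\end{bmatrix}.$$ Moreover, the same conclusion holds if, for some fixed integer $n\ge 3$, we impose the extra relation $x^n=0$ on $S$ and replace $R$ by $F\langle a,b\mid a^{n-1}=0\rangle$ (with $I=R(1-ba)$, $T$, $Q$, $X$ formed from this new $R$ by the same formulas).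
   Context: All algebras are associative and unital. $F\langle \text{generators}\mid\text{relations}\rangle$ denotes the unital associative $F$-algebra presented by the given generators and relations. $T$ is the set of $2\times 2$ matrices over $R$ whose $(1,1)$ and $(2,1)$ entries lie in $R$, whose $(1,2)$ entry lies in the left ideal $I$, and whose $(2,2)$ entry lies in $F1+I$. *)

theory Defs
  imports "HOL-Algebra.QuotRing" "HOL-Algebra.Module"
begin

text \<open>
  Associative unital algebras over \<open>F\<close> are records of type \<open>module\<close>: a ring together
  with a scalar multiplication.  (The library locale \<open>algebra\<close> is not used because it requires a
  commutative ring.)
\<close>

text \<open>
  Elements of the free algebra are finitely supported functions on words; such a function \<open>p\<close>
  stands for the linear combination of the words \<open>w\<close> with coefficients \<open>p w\<close>.  A word has
  finitely many factorizations \<open>w = take i w @ drop i w\<close>, so the product is a convolution over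
  these.
\<close>

definition free_algebra :: "('f, 'm) ring_scheme \<Rightarrow> ('f, 'x list \<Rightarrow> 'f) module" where
  "free_algebra F =
    \<lparr>carrier = {p. (\<forall>w. p w \<in> carrier F) \<and> finite {w. p w \<noteq> \<zero>\<^bsub>F\<^esub>}},
     mult = (\<lambda>p q w. \<Oplus>\<^bsub>F\<^esub>i\<in>{..length w}. p (take i w) \<otimes>\<^bsub>F\<^esub> q (drop i w)),
     one = (\<lambda>w. if w = [] then \<one>\<^bsub>F\<^esub> else \<zero>\<^bsub>F\<^esub>),
     zero = (\<lambda>w. \<zero>\<^bsub>F\<^esub>),
     add = (\<lambda>p q w. p w \<oplus>\<^bsub>F\<^esub> q w),
     smult = (\<lambda>c p w. c \<otimes>\<^bsub>F\<^esub> p w)\<rparr>"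

definition free_gen :: "('f, 'm) ring_scheme \<Rightarrow> 'x \<Rightarrow> 'x list \<Rightarrow> 'f" where
  "free_gen F x = (\<lambda>w. if w = [x] then \<one>\<^bsub>F\<^esub> else \<zero>\<^bsub>F\<^esub>)"

definition quot_algebra ::
    "('f, 'a, 'k) module_scheme \<Rightarrow> 'a set \<Rightarrow> ('f, 'a set) module" where
  "quot_algebra A J =
    \<lparr>carrier = carrier (A Quot J),
     mult = mult (A Quot J),
     one = \<one>\<^bsub>A Quot J\<^esub>,
     zero = \<zero>\<^bsub>A Quot J\<^esub>,
     add = add (A Quot J),
     smult = (\<lambda>c U. \<Union>u\<in>U. J +>\<^bsub>A\<^esub> (c \<odot>\<^bsub>A\<^esub> u))\<rparr>"

text \<open>
  A set \<open>rels\<close> of elements of the free algebra presents the algebra in which these elements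
  become zero: a relation \<open>u = v\<close> is encoded as \<open>u - v\<close>.
\<close>

definition presented_algebra ::
    "('f, 'm) ring_scheme \<Rightarrow> ('x list \<Rightarrow> 'f) set \<Rightarrow> ('f, ('x list \<Rightarrow> 'f) set) module" where
  "presented_algebra F rels = quot_algebra (free_algebra F) (Idl\<^bsub>free_algebra F\<^esub> rels)"

definition presented_gen ::
    "('f, 'm) ring_scheme \<Rightarrow> ('x list \<Rightarrow> 'f) set \<Rightarrow> 'x \<Rightarrow> ('x list \<Rightarrow> 'f) set" where
  "presented_gen F rels x = (Idl\<^bsub>free_algebra F\<^esub> rels) +>\<^bsub>free_algebra F\<^esub> free_gen F x"

definition algebra_iso ::
    "('f, 'm) ring_scheme \<Rightarrow> ('f, 'a, 'k) module_scheme \<Rightarrow> ('f, 'b, 'l) module_scheme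
      \<Rightarrow> ('a \<Rightarrow> 'b) set" where
  "algebra_iso F A B =
    {h \<in> ring_iso A B. \<forall>c\<in>carrier F. \<forall>u\<in>carrier A. h (c \<odot>\<^bsub>A\<^esub> u) = c \<odot>\<^bsub>B\<^esub> h u}"

text \<open>The entries of \<open>Mat2 p q r s\<close> are listed row by row: the rows are \<open>p q\<close> and \<open>r s\<close>.\<close>

datatype 'a mat2 = Mat2 (e11: 'a) (e12: 'a) (e21: 'a) (e22: 'a)

definition mat2_algebra :: "('f, 'a, 'k) module_scheme \<Rightarrow> ('f, 'a mat2) module" where
  "mat2_algebra R =
    \<lparr>carrier = {M. set_mat2 M \<subseteq> carrier R},
     mult = (\<lambda>M N. Mat2
       (e11 M \<otimes>\<^bsub>R\<^esub> e11 N \<oplus>\<^bsub>R\<^esub> e12 M \<otimes>\<^bsub>R\<^esub> e21 N) (e11 M \<otimes>\<^bsub>R\<^esub> e12 N \<oplus>\<^bsub>R\<^esub> e12 M \<otimes>\<^bsub>R\<^esub> e22 N)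
       (e21 M \<otimes>\<^bsub>R\<^esub> e11 N \<oplus>\<^bsub>R\<^esub> e22 M \<otimes>\<^bsub>R\<^esub> e21 N) (e21 M \<otimes>\<^bsub>R\<^esub> e12 N \<oplus>\<^bsub>R\<^esub> e22 M \<otimes>\<^bsub>R\<^esub> e22 N)),
     one = Mat2 \<one>\<^bsub>R\<^esub> \<zero>\<^bsub>R\<^esub> \<zero>\<^bsub>R\<^esub> \<one>\<^bsub>R\<^esub>,
     zero = Mat2 \<zero>\<^bsub>R\<^esub> \<zero>\<^bsub>R\<^esub> \<zero>\<^bsub>R\<^esub> \<zero>\<^bsub>R\<^esub>,
     add = (\<lambda>M N. Mat2
       (e11 M \<oplus>\<^bsub>R\<^esub> e11 N) (e12 M \<oplus>\<^bsub>R\<^esub> e12 N)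
       (e21 M \<oplus>\<^bsub>R\<^esub> e21 N) (e22 M \<oplus>\<^bsub>R\<^esub> e22 N)),
     smult = (\<lambda>c. map_mat2 (\<lambda>u. c \<odot>\<^bsub>R\<^esub> u))\<rparr>"

definition I_ideal :: "('a, 'k) ring_scheme \<Rightarrow> 'a \<Rightarrow> 'a \<Rightarrow> 'a set" where
  "I_ideal R a b = {r \<otimes>\<^bsub>R\<^esub> (\<one>\<^bsub>R\<^esub> \<ominus>\<^bsub>R\<^esub> b \<otimes>\<^bsub>R\<^esub> a) | r. r \<in> carrier R}"

definition scalars_plus_I ::
    "('f, 'm) ring_scheme \<Rightarrow> ('f, 'a, 'k) module_scheme \<Rightarrow> 'a \<Rightarrow> 'a \<Rightarrow> 'a set" where
  "scalars_plus_I F R a b =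
    {c \<odot>\<^bsub>R\<^esub> \<one>\<^bsub>R\<^esub> \<oplus>\<^bsub>R\<^esub> i | c i. c \<in> carrier F \<and> i \<in> I_ideal R a b}"

definition T_algebra ::
    "('f, 'm) ring_scheme \<Rightarrow> ('f, 'a, 'k) module_scheme \<Rightarrow> 'a \<Rightarrow> 'a \<Rightarrow> ('f, 'a mat2) module" where
  "T_algebra F R a b = (mat2_algebra R)
    \<lparr>carrier := {Mat2 r i s t | r i s t.
       r \<in> carrier R \<and> i \<in> I_ideal R a b \<and> s \<in> carrier R \<and> t \<in> scalars_plus_I F R a b}\<rparr>"

definition Q_mat :: "('a, 'k) ring_scheme \<Rightarrow> 'a \<Rightarrow> 'a \<Rightarrow> 'a mat2" where
  "Q_mat R a b = Mat2 b (\<one>\<^bsub>R\<^esub> \<ominus>\<^bsub>R\<^esub> b \<otimes>\<^bsub>R\<^esub> a) \<zero>\<^bsub>R\<^esub> \<zero>\<^bsub>R\<^esub>"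

definition X_mat :: "('a, 'k) ring_scheme \<Rightarrow> 'a \<Rightarrow> 'a mat2" where
  "X_mat R a = Mat2 a \<zero>\<^bsub>R\<^esub> \<one>\<^bsub>R\<^esub> \<zero>\<^bsub>R\<^esub>"

datatype gen_ab = Gen_a | Gen_b

datatype gen_qx = Gen_q | Gen_x

definition S_rels :: "('f, 'm) ring_scheme \<Rightarrow> (gen_qx list \<Rightarrow> 'f) set" where
  "S_rels F = (let A = free_algebra F; q = free_gen F Gen_q; x = free_gen F Gen_x
    in {q \<ominus>\<^bsub>A\<^esub> q \<otimes>\<^bsub>A\<^esub> x \<otimes>\<^bsub>A\<^esub> q, x \<ominus>\<^bsub>A\<^esub> x \<otimes>\<^bsub>A\<^esub> q \<otimes>\<^bsub>A\<^esub> x})"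

definition S_nil_rels :: "('f, 'm) ring_scheme \<Rightarrow> nat \<Rightarrow> (gen_qx list \<Rightarrow> 'f) set" where
  "S_nil_rels F n = insert (free_gen F Gen_x [^]\<^bsub>free_algebra F\<^esub> n) (S_rels F)"

definition R_nil_rels :: "('f, 'm) ring_scheme \<Rightarrow> nat \<Rightarrow> (gen_ab list \<Rightarrow> 'f) set" where
  "R_nil_rels F n = {free_gen F Gen_a [^]\<^bsub>free_algebra F\<^esub> (n - 1)}"

end

theory Submission
  imports Defs
begin

text \<open>
  Put \<open>e = q x\<close>, an idempotent of \<open>S\<close> with \<open>e q = q\<close> and \<open>x e = x\<close>.  The assignment
  \<open>a \<mapsto> q x x\<close>, \<open>b \<mapsto> q q x\<close> defines a unital homomorphism \<open>\<phi>\<close> from \<open>R\<close> to the corner ring \<open>e S e\<close>.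
  With \<open>y = (1 - e) x\<close> and \<open>z = q (1 - e)\<close> one has \<open>x = \<phi> a + y\<close>, \<open>q (1 - e) = z\<close>,
  \<open>q y = \<phi> (1 - b a)\<close>, \<open>x y = 0\<close> and \<open>x (1 - e) = 0\<close>, so the elements
  \<open>c (1 - e) + \<phi> r + \<phi> r' z + y \<phi> s + y \<phi> s' z\<close> form a left ideal that contains \<open>1\<close>; hence they
  exhaust \<open>S\<close>.  The homomorphism to \<open>T\<close> given by the presentation of \<open>S\<close> sends such an element to
  the matrix with rows \<open>r\<close>, \<open>r' (1 - b a)\<close> and \<open>s\<close>, \<open>c + s' (1 - b a)\<close>.  So it is onto, and it is
  injective because \<open>1 - b a\<close> is right cancellable in \<open>R\<close> (compare terms of lowest degree) and no
  nonzero scalar lies in \<open>I\<close> (represent \<open>a\<close>, \<open>b\<close> by the matrix units \<open>E\<^sub>2\<^sub>1\<close>, \<open>E\<^sub>1\<^sub>2\<close> over \<open>F\<close>; as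
  \<open>n - 1 \<ge> 2\<close>, this respects \<open>a ^ (n - 1) = 0\<close>).
\<close>

section \<open>Associative algebras\<close>

text \<open>The two axioms make the product bilinear over \<open>F\<close>; this is what ties the
  ring structure to the module structure.\<close>

locale assoc_algebra = ring A + scalars: module F A
  for F :: "('f, 'm) ring_scheme" and A :: "('f, 'a, 'k) module_scheme" (structure) +
  assumes smult_mult_left:
      "\<lbrakk>c \<in> carrier F; u \<in> carrier A; v \<in> carrier A\<rbrakk> \<Longrightarrow> (c \<odot> u) \<otimes> v = c \<odot> (u \<otimes> v)"
    and smult_mult_right:
      "\<lbrakk>c \<in> carrier F; u \<in> carrier A; v \<in> carrier A\<rbrakk> \<Longrightarrow> u \<otimes> (c \<odot> v) = c \<odot> (u \<otimes> v)"

text \<open>Negatives come from the scalars: (-1) u + 1 u = 0 u = 0, so (-1) u is an additive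
  inverse of \<open>u\<close>.\<close>

lemma assoc_algebraI:
  fixes F (structure) and A (structure)
  assumes F: "cring F"
    and closed: "\<zero>\<^bsub>A\<^esub> \<in> carrier A" "\<one>\<^bsub>A\<^esub> \<in> carrier A"
      "\<And>u v. \<lbrakk>u \<in> carrier A; v \<in> carrier A\<rbrakk> \<Longrightarrow> u \<oplus>\<^bsub>A\<^esub> v \<in> carrier A"
      "\<And>u v. \<lbrakk>u \<in> carrier A; v \<in> carrier A\<rbrakk> \<Longrightarrow> u \<otimes>\<^bsub>A\<^esub> v \<in> carrier A"
      "\<And>c u. \<lbrakk>c \<in> carrier F; u \<in> carrier A\<rbrakk> \<Longrightarrow> c \<odot>\<^bsub>A\<^esub> u \<in> carrier A"
    and add: "\<And>u. u \<in> carrier A \<Longrightarrow> \<zero>\<^bsub>A\<^esub> \<oplus>\<^bsub>A\<^esub> u = u"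
      "\<And>u v. \<lbrakk>u \<in> carrier A; v \<in> carrier A\<rbrakk> \<Longrightarrow> u \<oplus>\<^bsub>A\<^esub> v = v \<oplus>\<^bsub>A\<^esub> u"
      "\<And>u v w. \<lbrakk>u \<in> carrier A; v \<in> carrier A; w \<in> carrier A\<rbrakk>
        \<Longrightarrow> (u \<oplus>\<^bsub>A\<^esub> v) \<oplus>\<^bsub>A\<^esub> w = u \<oplus>\<^bsub>A\<^esub> (v \<oplus>\<^bsub>A\<^esub> w)"
    and mult: "\<And>u. u \<in> carrier A \<Longrightarrow> \<one>\<^bsub>A\<^esub> \<otimes>\<^bsub>A\<^esub> u = u" "\<And>u. u \<in> carrier A \<Longrightarrow> u \<otimes>\<^bsub>A\<^esub> \<one>\<^bsub>A\<^esub> = u"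
      "\<And>u v w. \<lbrakk>u \<in> carrier A; v \<in> carrier A; w \<in> carrier A\<rbrakk>
        \<Longrightarrow> (u \<otimes>\<^bsub>A\<^esub> v) \<otimes>\<^bsub>A\<^esub> w = u \<otimes>\<^bsub>A\<^esub> (v \<otimes>\<^bsub>A\<^esub> w)"
    and distr: "\<And>u v w. \<lbrakk>u \<in> carrier A; v \<in> carrier A; w \<in> carrier A\<rbrakk>
        \<Longrightarrow> (u \<oplus>\<^bsub>A\<^esub> v) \<otimes>\<^bsub>A\<^esub> w = u \<otimes>\<^bsub>A\<^esub> w \<oplus>\<^bsub>A\<^esub> v \<otimes>\<^bsub>A\<^esub> w"
      "\<And>u v w. \<lbrakk>u \<in> carrier A; v \<in> carrier A; w \<in> carrier A\<rbrakk>
        \<Longrightarrow> w \<otimes>\<^bsub>A\<^esub> (u \<oplus>\<^bsub>A\<^esub> v) = w \<otimes>\<^bsub>A\<^esub> u \<oplus>\<^bsub>A\<^esub> w \<otimes>\<^bsub>A\<^esub> v"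
    and smult: "\<And>u. u \<in> carrier A \<Longrightarrow> \<zero> \<odot>\<^bsub>A\<^esub> u = \<zero>\<^bsub>A\<^esub>"
      "\<And>u. u \<in> carrier A \<Longrightarrow> \<one> \<odot>\<^bsub>A\<^esub> u = u"
      "\<And>c d u. \<lbrakk>c \<in> carrier F; d \<in> carrier F; u \<in> carrier A\<rbrakk>
        \<Longrightarrow> (c \<oplus> d) \<odot>\<^bsub>A\<^esub> u = c \<odot>\<^bsub>A\<^esub> u \<oplus>\<^bsub>A\<^esub> d \<odot>\<^bsub>A\<^esub> u"
      "\<And>c u v. \<lbrakk>c \<in> carrier F; u \<in> carrier A; v \<in> carrier A\<rbrakk>
        \<Longrightarrow> c \<odot>\<^bsub>A\<^esub> (u \<oplus>\<^bsub>A\<^esub> v) = c \<odot>\<^bsub>A\<^esub> u \<oplus>\<^bsub>A\<^esub> c \<odot>\<^bsub>A\<^esub> v"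
      "\<And>c d u. \<lbrakk>c \<in> carrier F; d \<in> carrier F; u \<in> carrier A\<rbrakk>
        \<Longrightarrow> (c \<otimes> d) \<odot>\<^bsub>A\<^esub> u = c \<odot>\<^bsub>A\<^esub> (d \<odot>\<^bsub>A\<^esub> u)"
      "\<And>c u v. \<lbrakk>c \<in> carrier F; u \<in> carrier A; v \<in> carrier A\<rbrakk>
        \<Longrightarrow> (c \<odot>\<^bsub>A\<^esub> u) \<otimes>\<^bsub>A\<^esub> v = c \<odot>\<^bsub>A\<^esub> (u \<otimes>\<^bsub>A\<^esub> v)"
      "\<And>c u v. \<lbrakk>c \<in> carrier F; u \<in> carrier A; v \<in> carrier A\<rbrakk>
        \<Longrightarrow> u \<otimes>\<^bsub>A\<^esub> (c \<odot>\<^bsub>A\<^esub> v) = c \<odot>\<^bsub>A\<^esub> (u \<otimes>\<^bsub>A\<^esub> v)"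
  shows "assoc_algebra F A"
proof -
  interpret F: cring F by fact
  have inv: "\<exists>v\<in>carrier A. v \<oplus>\<^bsub>A\<^esub> u = \<zero>\<^bsub>A\<^esub>" if u: "u \<in> carrier A" for u
  proof
    have "(\<ominus> \<one>) \<odot>\<^bsub>A\<^esub> u \<oplus>\<^bsub>A\<^esub> \<one> \<odot>\<^bsub>A\<^esub> u = (\<ominus> \<one> \<oplus> \<one>) \<odot>\<^bsub>A\<^esub> u"
      using u by (intro smult(3)[symmetric]) auto
    then show "(\<ominus> \<one>) \<odot>\<^bsub>A\<^esub> u \<oplus>\<^bsub>A\<^esub> u = \<zero>\<^bsub>A\<^esub>"
      using u by (simp add: smult F.l_neg)
  qed (use u closed in auto)
  have grp: "abelian_group A"
    by (rule abelian_groupI) (use closed add inv in auto)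
  have "ring A"
    by (rule ringI[OF grp monoidI]) (use closed mult distr in auto)
  moreover have "module F A"
    by (rule moduleI[OF F grp]) (use closed smult in auto)
  ultimately show ?thesis
    by (intro assoc_algebra.intro assoc_algebra_axioms.intro smult(6,7))
qed

context assoc_algebra
begin

lemma scalar_mult:
  "\<lbrakk>c \<in> carrier F; u \<in> carrier A\<rbrakk> \<Longrightarrow> (c \<odot> \<one>) \<otimes> u = c \<odot> u"
  by (simp add: smult_mult_left)

text \<open>Since c u = (c 1) u, every ring ideal is a subspace. Hence ring ideals, and the
  \<open>Idl\<close> of the presentations, are also the ideals of the algebra.\<close>

lemma ideal_smult_closed:
  assumes "ideal J A" "c \<in> carrier F" "u \<in> J"
  shows "c \<odot> u \<in> J"
proof -
  interpret J: ideal J A by fact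
  show ?thesis
    using J.I_l_closed[of u "c \<odot> \<one>"] assms J.a_subset by (auto simp: scalar_mult)
qed

lemma minus_eq_smult: "u \<in> carrier A \<Longrightarrow> \<ominus> u = (\<ominus>\<^bsub>F\<^esub> \<one>\<^bsub>F\<^esub>) \<odot> u"
  by (simp add: scalars.smult_l_minus)

text \<open>The unit of \<open>B\<close> may differ from that of \<open>A\<close>. This covers
  corners, whose unit is an idempotent, as well as subalgebras such as \<open>T_algebra\<close>
  inside the matrices.\<close>

lemma assoc_subalgebra:
  fixes B :: "('f, 'a, 'l) module_scheme"
  assumes sub: "carrier B \<subseteq> carrier A"
    and ops: "mult B = mult A" "add B = add A" "zero B = zero A" "smult B = smult A"
    and closed: "\<zero> \<in> carrier B" "\<one>\<^bsub>B\<^esub> \<in> carrier B"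
      "\<And>u v. \<lbrakk>u \<in> carrier B; v \<in> carrier B\<rbrakk> \<Longrightarrow> u \<oplus> v \<in> carrier B"
      "\<And>u v. \<lbrakk>u \<in> carrier B; v \<in> carrier B\<rbrakk> \<Longrightarrow> u \<otimes> v \<in> carrier B"
      "\<And>c u. \<lbrakk>c \<in> carrier F; u \<in> carrier B\<rbrakk> \<Longrightarrow> c \<odot> u \<in> carrier B"
    and unit: "\<And>u. u \<in> carrier B \<Longrightarrow> \<one>\<^bsub>B\<^esub> \<otimes> u = u" "\<And>u. u \<in> carrier B \<Longrightarrow> u \<otimes> \<one>\<^bsub>B\<^esub> = u"
  shows "assoc_algebra F B"
proof -
  have inA: "\<And>u. u \<in> carrier B \<Longrightarrow> u \<in> carrier A" using sub by blast
  show ?thesis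
    by (rule assoc_algebraI, unfold ops)
      (use closed in \<open>auto intro: scalars.R.is_cring simp: inA unit a_ac m_assoc l_distr r_distr
        scalars.smult_l_distr scalars.smult_r_distr scalars.smult_assoc1
        smult_mult_left smult_mult_right\<close>)
qed

end

section \<open>Homomorphisms of algebras\<close>

definition algebra_hom ::
    "('f, 'm) ring_scheme \<Rightarrow> ('f, 'a, 'k) module_scheme \<Rightarrow> ('f, 'b, 'l) module_scheme
      \<Rightarrow> ('a \<Rightarrow> 'b) set" where
  "algebra_hom F A B =
    {h \<in> ring_hom A B. \<forall>c\<in>carrier F. \<forall>u\<in>carrier A. h (c \<odot>\<^bsub>A\<^esub> u) = c \<odot>\<^bsub>B\<^esub> h u}"

lemma algebra_homD:
  assumes "h \<in> algebra_hom F A B"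
  shows "\<And>u. u \<in> carrier A \<Longrightarrow> h u \<in> carrier B"
    and "\<And>u v. \<lbrakk>u \<in> carrier A; v \<in> carrier A\<rbrakk> \<Longrightarrow> h (u \<oplus>\<^bsub>A\<^esub> v) = h u \<oplus>\<^bsub>B\<^esub> h v"
    and "\<And>u v. \<lbrakk>u \<in> carrier A; v \<in> carrier A\<rbrakk> \<Longrightarrow> h (u \<otimes>\<^bsub>A\<^esub> v) = h u \<otimes>\<^bsub>B\<^esub> h v"
    and "h \<one>\<^bsub>A\<^esub> = \<one>\<^bsub>B\<^esub>"
    and "\<And>c u. \<lbrakk>c \<in> carrier F; u \<in> carrier A\<rbrakk> \<Longrightarrow> h (c \<odot>\<^bsub>A\<^esub> u) = c \<odot>\<^bsub>B\<^esub> h u"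
  using assms by (auto simp: algebra_hom_def ring_hom_def Pi_def)

lemma algebra_hom_zero:
  assumes "assoc_algebra F A" "assoc_algebra F B" "h \<in> algebra_hom F A B"
  shows "h \<zero>\<^bsub>A\<^esub> = \<zero>\<^bsub>B\<^esub>"
proof -
  interpret A: assoc_algebra F A by fact
  interpret B: assoc_algebra F B by fact
  show ?thesis
    using assms(3) ring_hom_zero[of h A B] A.ring_axioms B.ring_axioms
    by (auto simp: algebra_hom_def)
qed

lemma algebra_hom_diff:
  assumes "assoc_algebra F A" "assoc_algebra F B" "h \<in> algebra_hom F A B"
    and "u \<in> carrier A" "v \<in> carrier A"
  shows "h (u \<ominus>\<^bsub>A\<^esub> v) = h u \<ominus>\<^bsub>B\<^esub> h v"
proof -
  interpret A: assoc_algebra F A by fact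
  interpret B: assoc_algebra F B by fact
  note h = algebra_homD[OF assms(3)]
  show ?thesis
    using assms(4,5) by (simp add: a_minus_def A.minus_eq_smult B.minus_eq_smult h)
qed

lemma algebra_hom_pow:
  assumes "assoc_algebra F A" "h \<in> algebra_hom F A B" "u \<in> carrier A"
  shows "h (u [^]\<^bsub>A\<^esub> (n::nat)) = h u [^]\<^bsub>B\<^esub> n"
proof -
  interpret A: assoc_algebra F A by fact
  show ?thesis
    using assms(3) by (induction n) (simp_all add: algebra_homD[OF assms(2)])
qed

lemma algebra_hom_kernel:
  assumes "assoc_algebra F A" "assoc_algebra F B" "h \<in> algebra_hom F A B"
  shows "ideal (a_kernel A B h) A"
proof -
  interpret A: assoc_algebra F A by fact
  interpret B: assoc_algebra F B by fact
  show ?thesis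
    using assms(3) A.ring_axioms B.ring_axioms
    by (intro ring_hom_ring.kernel_is_ideal ring_hom_ringI2) (auto simp: algebra_hom_def)
qed

section \<open>Free algebras\<close>

text \<open>The product of the free algebra, detached from the record and from finite support, so
  that identities can be proved for arbitrary coefficient functions one word at a time.\<close>

definition conv :: "('f, 'm) ring_scheme \<Rightarrow> ('x list \<Rightarrow> 'f) \<Rightarrow> ('x list \<Rightarrow> 'f) \<Rightarrow> 'x list \<Rightarrow> 'f" where
  "conv F p q w = (\<Oplus>\<^bsub>F\<^esub>i\<in>{..length w}. p (take i w) \<otimes>\<^bsub>F\<^esub> q (drop i w))"

context cring
begin

lemma conv_Nil [simp]:
  assumes "\<And>v. p v \<in> carrier R" "\<And>v. q v \<in> carrier R"
  shows "conv R p q [] = p [] \<otimes> q []"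
proof -
  have "(\<Oplus>i\<in>{0::nat}. p [] \<otimes> q []) = p [] \<otimes> q []"
    by (subst add.finprod_insert) (auto simp: assms)
  then show ?thesis by (simp add: conv_def)
qed

text \<open>Apart from the empty left factor, each left factor of \<open>x # w\<close> starts with
  \<open>x\<close>; stripping that letter gives a convolution over \<open>w\<close>. Induction on
  words by this recursion takes the place of reindexing double sums.\<close>

lemma conv_Cons [simp]:
  assumes "\<And>v. p v \<in> carrier R" "\<And>v. q v \<in> carrier R"
  shows "conv R p q (x # w) = p [] \<otimes> q (x # w) \<oplus> conv R (\<lambda>v. p (x # v)) q w"
proof -
  let ?f = "\<lambda>i. p (take i (x # w)) \<otimes> q (drop i (x # w))"
  have "finsum R ?f {..Suc (length w)} = finsum R (\<lambda>i. ?f (Suc i)) {..length w} \<oplus> ?f 0"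
    using assms by (intro add.finprod_Suc2) auto
  moreover have "finsum R (\<lambda>i. ?f (Suc i)) {..length w} \<in> carrier R"
    using assms by (intro finsum_closed) auto
  ultimately show ?thesis
    using assms by (simp add: conv_def a_comm)
qed

lemma conv_closed [simp]:
  "\<lbrakk>\<And>v. p v \<in> carrier R; \<And>v. q v \<in> carrier R\<rbrakk> \<Longrightarrow> conv R p q w \<in> carrier R"
  by (auto simp: conv_def intro!: finsum_closed m_closed)

lemma conv_add_left:
  assumes "\<And>v. p v \<in> carrier R" "\<And>v. p' v \<in> carrier R" "\<And>v. q v \<in> carrier R"
  shows "conv R (\<lambda>v. p v \<oplus> p' v) q w = conv R p q w \<oplus> conv R p' q w"
  unfolding conv_def by (subst finsum_addf[symmetric]) (auto simp: l_distr assms)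

lemma conv_add_right:
  assumes "\<And>v. p v \<in> carrier R" "\<And>v. q v \<in> carrier R" "\<And>v. q' v \<in> carrier R"
  shows "conv R p (\<lambda>v. q v \<oplus> q' v) w = conv R p q w \<oplus> conv R p q' w"
  unfolding conv_def by (subst finsum_addf[symmetric]) (auto simp: r_distr assms)

lemma conv_smult_left:
  assumes "c \<in> carrier R" "\<And>v. p v \<in> carrier R" "\<And>v. q v \<in> carrier R"
  shows "conv R (\<lambda>v. c \<otimes> p v) q w = c \<otimes> conv R p q w"
  unfolding conv_def by (subst finsum_rdistr) (auto simp: m_assoc assms)

lemma conv_smult_right:
  assumes "c \<in> carrier R" "\<And>v. p v \<in> carrier R" "\<And>v. q v \<in> carrier R"
  shows "conv R p (\<lambda>v. c \<otimes> q v) w = c \<otimes> conv R p q w"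
  unfolding conv_def by (subst finsum_rdistr) (auto simp: m_lcomm assms)

lemma conv_zero_left: "(\<And>v. q v \<in> carrier R) \<Longrightarrow> conv R (\<lambda>v. \<zero>) q w = \<zero>"
  by (induction w) auto

lemma conv_one_left:
  "(\<And>v. q v \<in> carrier R) \<Longrightarrow> conv R (\<lambda>v. if v = [] then \<one> else \<zero>) q w = q w"
  by (cases w) (auto simp: conv_zero_left)

lemma conv_one_right:
  "(\<And>v. p v \<in> carrier R) \<Longrightarrow> conv R p (\<lambda>v. if v = [] then \<one> else \<zero>) w = p w"
  by (induction w arbitrary: p) auto

text \<open>Induction on the word, with \<open>p\<close> arbitrary because the recursion replaces it
  by its shift. The shift of \<open>conv R p q\<close> splits by the same recursion, and linearity
  in the left argument does the rest.\<close>

lemma conv_assoc: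
  assumes "\<And>v. p v \<in> carrier R" "\<And>v. q v \<in> carrier R" "\<And>v. r v \<in> carrier R"
  shows "conv R (conv R p q) r w = conv R p (conv R q r) w"
  using assms
proof (induction w arbitrary: p)
  case Nil
  then show ?case by (simp add: m_assoc)
next
  case (Cons x w)
  note [simp] = Cons.prems
  let ?q = "\<lambda>v. q (x # v)" and ?p = "\<lambda>v. p (x # v)"
  have *: "(\<lambda>v. conv R p q (x # v)) = (\<lambda>v. p [] \<otimes> ?q v \<oplus> conv R ?p q v)"
    by simp
  have "conv R (\<lambda>v. conv R p q (x # v)) r w
      = p [] \<otimes> conv R ?q r w \<oplus> conv R (conv R ?p q) r w"
    unfolding * by (subst conv_add_left) (auto simp: conv_smult_left)
  also have "\<dots> = p [] \<otimes> conv R ?q r w \<oplus> conv R ?p (conv R q r) w"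
    by (subst Cons.IH) auto
  finally show ?case
    by (simp add: r_distr m_assoc a_assoc)
qed

text \<open>This bounds supports of products. It yields both closure of the free algebra under
  multiplication and the description of monomial ideals.\<close>

lemma conv_nonzeroE:
  assumes "conv R p q w \<noteq> \<zero>" "\<And>v. p v \<in> carrier R" "\<And>v. q v \<in> carrier R"
  obtains u v where "w = u @ v" "p u \<noteq> \<zero>" "q v \<noteq> \<zero>"
proof -
  have "\<exists>i. p (take i w) \<noteq> \<zero> \<and> q (drop i w) \<noteq> \<zero>"
  proof (rule ccontr)
    assume "\<not> ?thesis"
    then have "\<And>i. p (take i w) \<otimes> q (drop i w) = \<zero>" by (metis assms(2,3) l_null r_null)
    then have "conv R p q w = \<zero>" by (simp add: conv_def)
    with assms(1) show False by simp
  qed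
  then show thesis using that append_take_drop_id by metis
qed

lemma free_algebra_carrier_iff:
  "p \<in> carrier (free_algebra R) \<longleftrightarrow> (\<forall>w. p w \<in> carrier R) \<and> finite {w. p w \<noteq> \<zero>}"
  by (auto simp: free_algebra_def)

lemma free_algebra_coeff: "p \<in> carrier (free_algebra R) \<Longrightarrow> p w \<in> carrier R"
  by (simp add: free_algebra_carrier_iff)

lemma free_algebra_mult: "p \<otimes>\<^bsub>free_algebra R\<^esub> q = conv R p q"
  by (simp add: free_algebra_def conv_def fun_eq_iff)

lemma free_algebra_simps:
  "\<zero>\<^bsub>free_algebra R\<^esub> = (\<lambda>w. \<zero>)"
  "\<one>\<^bsub>free_algebra R\<^esub> = (\<lambda>w. if w = [] then \<one> else \<zero>)"
  "p \<oplus>\<^bsub>free_algebra R\<^esub> q = (\<lambda>w. p w \<oplus> q w)"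
  "c \<odot>\<^bsub>free_algebra R\<^esub> p = (\<lambda>w. c \<otimes> p w)"
  by (simp_all add: free_algebra_def)

lemma free_algebra_assoc_algebra: "assoc_algebra R (free_algebra R)"
proof (rule assoc_algebraI[OF is_cring], unfold free_algebra_simps free_algebra_mult, goal_cases)
  case (3 u v)
  then have "{w. u w \<oplus> v w \<noteq> \<zero>} \<subseteq> {w. u w \<noteq> \<zero>} \<union> {w. v w \<noteq> \<zero>}" by auto
  with 3 show ?case
    by (auto simp: free_algebra_carrier_iff intro: finite_subset)
next
  case (4 u v)
  let ?S = "\<lambda>p. {w. p w \<noteq> \<zero>}"
  \<comment> \<open>Each word in the support of the product is a concatenation of words from the two
    supports, and there are only finitely many of these.\<close>
  have "?S (conv R u v) \<subseteq> (\<lambda>(a, b). a @ b) ` (?S u \<times> ?S v)"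
  proof
    fix w assume "w \<in> ?S (conv R u v)"
    then obtain a b where "w = a @ b" "u a \<noteq> \<zero>" "v b \<noteq> \<zero>"
      using 4 by (auto simp: free_algebra_carrier_iff elim: conv_nonzeroE)
    then show "w \<in> (\<lambda>(a, b). a @ b) ` (?S u \<times> ?S v)" by force
  qed
  then have "finite (?S (conv R u v))"
    by (rule finite_subset) (use 4 in \<open>simp add: free_algebra_carrier_iff\<close>)
  with 4 show ?case
    by (simp add: free_algebra_carrier_iff)
next
  case (5 c u)
  then have "{w. c \<otimes> u w \<noteq> \<zero>} \<subseteq> {w. u w \<noteq> \<zero>}" by auto
  with 5 show ?case
    by (auto simp: free_algebra_carrier_iff intro: finite_subset)
next
  case 1
  show ?case by (simp add: free_algebra_carrier_iff)
next
  case 2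
  show ?case by (simp add: free_algebra_carrier_iff)
next
  case (6 u)
  then show ?case by (simp add: free_algebra_carrier_iff)
next
  case (7 u v)
  then show ?case by (intro ext) (simp add: a_comm free_algebra_carrier_iff)
next
  case (8 u v w)
  then show ?case by (intro ext) (simp add: a_assoc free_algebra_carrier_iff)
next
  case (9 u)
  then show ?case by (intro ext) (simp add: conv_one_left free_algebra_carrier_iff)
next
  case (10 u)
  then show ?case by (intro ext) (simp add: conv_one_right free_algebra_carrier_iff)
next
  case (11 u v w)
  then show ?case by (intro ext conv_assoc) (auto simp: free_algebra_carrier_iff)
next
  case (12 u v w)
  then show ?case by (intro ext conv_add_left) (auto simp: free_algebra_carrier_iff)
next
  case (13 u v w)
  then show ?case by (intro ext conv_add_right) (auto simp: free_algebra_carrier_iff)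
next
  case (14 u)
  then show ?case by (simp add: free_algebra_carrier_iff)
next
  case (15 u)
  then show ?case by (simp add: free_algebra_carrier_iff)
next
  case (16 c d u)
  then show ?case by (intro ext) (simp add: l_distr free_algebra_carrier_iff)
next
  case (17 c u v)
  then show ?case by (intro ext) (simp add: r_distr free_algebra_carrier_iff)
next
  case (18 c d u)
  then show ?case by (intro ext) (simp add: m_assoc free_algebra_carrier_iff)
next
  case (19 c u v)
  then show ?case by (intro ext conv_smult_left) (auto simp: free_algebra_carrier_iff)
next
  case (20 c u v)
  then show ?case by (intro ext conv_smult_right) (auto simp: free_algebra_carrier_iff)
qed

lemma free_gen_closed [simp]: "free_gen R x \<in> carrier (free_algebra R)"
  by (auto simp: free_algebra_carrier_iff free_gen_def)

end

section \<open>Generation by a set, monomials, and induction in the free algebra\<close>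

definition generates ::
    "('f, 'm) ring_scheme \<Rightarrow> ('f, 'a, 'k) module_scheme \<Rightarrow> 'a set \<Rightarrow> bool" where
  "generates F A G \<longleftrightarrow> (\<forall>X \<subseteq> carrier A.
     \<one>\<^bsub>A\<^esub> \<in> X \<longrightarrow> (\<forall>u\<in>X. \<forall>v\<in>X. u \<oplus>\<^bsub>A\<^esub> v \<in> X) \<longrightarrow> (\<forall>c\<in>carrier F. \<forall>u\<in>X. c \<odot>\<^bsub>A\<^esub> u \<in> X) \<longrightarrow>
     (\<forall>g\<in>G. \<forall>u\<in>X. g \<otimes>\<^bsub>A\<^esub> u \<in> X) \<longrightarrow> X = carrier A)"

text \<open>Multiplication by generators is required on the left only: words grow by prepending
  letters. The Peirce argument below relies on this form, as it computes only left multiplication by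
  \<open>q\<close> and \<open>x\<close>.\<close>

lemma generates_induct [consumes 2, case_names one add smult mult]:
  assumes "generates F A G" "u \<in> carrier A"
    and "P \<one>\<^bsub>A\<^esub>"
    and "\<And>u v. \<lbrakk>u \<in> carrier A; v \<in> carrier A; P u; P v\<rbrakk> \<Longrightarrow> P (u \<oplus>\<^bsub>A\<^esub> v)"
    and "\<And>c u. \<lbrakk>c \<in> carrier F; u \<in> carrier A; P u\<rbrakk> \<Longrightarrow> P (c \<odot>\<^bsub>A\<^esub> u)"
    and "\<And>g u. \<lbrakk>g \<in> G; u \<in> carrier A; P u\<rbrakk> \<Longrightarrow> P (g \<otimes>\<^bsub>A\<^esub> u)"
    and "assoc_algebra F A" "G \<subseteq> carrier A"
  shows "P u"
proof -
  interpret A: assoc_algebra F A by fact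
  have "{u \<in> carrier A. P u} = carrier A"
    by (rule assms(1)[unfolded generates_def, rule_format]) (use assms(3-6,8) in auto)
  with assms(2) show ?thesis by blast
qed

text \<open>Carries generation from the free algebra to its quotients: the elements that
  \<open>h\<close> maps into a closed set \<open>X\<close> satisfy the same closure conditions in
  \<open>A\<close>.\<close>

lemma generates_image:
  assumes A: "assoc_algebra F A" and h: "h \<in> algebra_hom F A B" "h ` carrier A = carrier B"
    and G: "generates F A G" "G \<subseteq> carrier A"
  shows "generates F B (h ` G)"
  unfolding generates_def
proof (intro allI impI)
  interpret A: assoc_algebra F A by fact
  note hom = algebra_homD[OF h(1)]
  fix X assume X: "X \<subseteq> carrier B" "\<one>\<^bsub>B\<^esub> \<in> X" "\<forall>u\<in>X. \<forall>v\<in>X. u \<oplus>\<^bsub>B\<^esub> v \<in> X"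
    "\<forall>c\<in>carrier F. \<forall>u\<in>X. c \<odot>\<^bsub>B\<^esub> u \<in> X" "\<forall>g\<in>h ` G. \<forall>u\<in>X. g \<otimes>\<^bsub>B\<^esub> u \<in> X"
  have "h u \<in> X" if "u \<in> carrier A" for u
    using G(1) that
  proof (induction rule: generates_induct)
    case (mult g u)
    then have "g \<in> carrier A" using G(2) by blast
    with mult X show ?case by (simp add: hom)
  qed (use X G A in \<open>auto simp: hom\<close>)
  then have "h ` carrier A \<subseteq> X" by auto
  then show "X = carrier B" using X(1) h(2) by simp
qed

definition monomial :: "('f, 'm) ring_scheme \<Rightarrow> 'f \<Rightarrow> 'x list \<Rightarrow> 'x list \<Rightarrow> 'f" where
  "monomial F c w = (\<lambda>v. if v = w then c else \<zero>\<^bsub>F\<^esub>)"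

context cring
begin

lemma monomial_closed [simp]: "c \<in> carrier R \<Longrightarrow> monomial R c w \<in> carrier (free_algebra R)"
  by (auto simp: free_algebra_carrier_iff monomial_def)

text \<open>In the recursion \<open>conv_Cons\<close> the shifted generator is the unit if the first
  letter is \<open>x\<close> and zero otherwise, so the unit and zero laws of \<open>conv\<close>
  finish the computation.\<close>

lemma free_gen_mult:
  assumes "p \<in> carrier (free_algebra R)"
  shows "free_gen R x \<otimes>\<^bsub>free_algebra R\<^esub> p
    = (\<lambda>w. case w of [] \<Rightarrow> \<zero> | y # v \<Rightarrow> if y = x then p v else \<zero>)"
proof -
  have p: "\<And>v. p v \<in> carrier R" using assms by (simp add: free_algebra_carrier_iff)
  have g: "\<And>v. free_gen R x v \<in> carrier R" by (simp add: free_gen_def)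
  have gen_Cons: "(\<lambda>v. free_gen R x (y # v))
      = (if y = x then (\<lambda>v. if v = [] then \<one> else \<zero>) else (\<lambda>v. \<zero>))" for y
    by (auto simp: free_gen_def)
  show ?thesis
  proof
    fix w
    show "(free_gen R x \<otimes>\<^bsub>free_algebra R\<^esub> p) w
        = (case w of [] \<Rightarrow> \<zero> | y # v \<Rightarrow> if y = x then p v else \<zero>)"
    proof (cases w)
      case Nil
      then show ?thesis by (simp add: free_algebra_mult p g) (simp add: free_gen_def p)
    next
      case (Cons y v)
      have "free_gen R x [] = \<zero>" by (simp add: free_gen_def)
      then show ?thesis
        using Cons by (simp add: free_algebra_mult p g gen_Cons conv_one_left conv_zero_left)
    qed
  qed
qed

lemma free_gen_mult_monomial:
  "c \<in> carrier R \<Longrightarrow> free_gen R x \<otimes>\<^bsub>free_algebra R\<^esub> monomial R c w = monomial R c (x # w)"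
  by (subst free_gen_mult, simp) (auto simp: monomial_def fun_eq_iff split: list.split)

lemma monomial_Nil:
  "c \<in> carrier R \<Longrightarrow> monomial R c [] = c \<odot>\<^bsub>free_algebra R\<^esub> \<one>\<^bsub>free_algebra R\<^esub>"
  by (auto simp: monomial_def free_algebra_simps)

lemma free_gen_eq_monomial: "free_gen R x = monomial R \<one> [x]"
  by (simp add: free_gen_def monomial_def)

lemma monomial_mult:
  assumes "c \<in> carrier R" "d \<in> carrier R"
  shows "monomial R c u \<otimes>\<^bsub>free_algebra R\<^esub> monomial R d v = monomial R (c \<otimes> d) (u @ v)"
proof -
  interpret A: assoc_algebra R "free_algebra R" by (rule free_algebra_assoc_algebra)
  show ?thesis
  proof (induction u)
    case Nil
    show ?case
      using assms by (simp add: monomial_Nil A.scalar_mult) (auto simp: free_algebra_simps monomial_def)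
  next
    case (Cons x u)
    then show ?case
      using assms by (simp flip: free_gen_mult_monomial add: A.m_assoc)
  qed
qed

lemma free_gen_pow:
  "free_gen R x [^]\<^bsub>free_algebra R\<^esub> (n::nat) = monomial R \<one> (replicate n x)"
proof -
  interpret A: assoc_algebra R "free_algebra R" by (rule free_algebra_assoc_algebra)
  show ?thesis
    by (induction n) (simp_all add: monomial_Nil free_gen_eq_monomial monomial_mult
      replicate_append_same)
qed

text \<open>\<open>p\<close> is assembled by restricting it to growing finite parts of its support.
  The monomial case concerns only terms of \<open>p\<close> itself, so facts about the support of
  \<open>p\<close> stay available there.\<close>

lemma free_algebra_induct [consumes 1, case_names zero monomial add]:
  assumes "p \<in> carrier (free_algebra R)"
    and "P \<zero>\<^bsub>free_algebra R\<^esub>"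
    and monom: "\<And>w. p w \<noteq> \<zero> \<Longrightarrow> P (monomial R (p w) w)"
    and add: "\<And>u v. \<lbrakk>u \<in> carrier (free_algebra R); v \<in> carrier (free_algebra R); P u; P v\<rbrakk>
      \<Longrightarrow> P (u \<oplus>\<^bsub>free_algebra R\<^esub> v)"
  shows "P p"
proof -
  have p: "\<And>w. p w \<in> carrier R" "finite {w. p w \<noteq> \<zero>}"
    using assms(1) by (simp_all add: free_algebra_carrier_iff)
  have "P (\<lambda>w. if w \<in> W then p w else \<zero>)" if "finite W" "W \<subseteq> {w. p w \<noteq> \<zero>}" for W
    using that
  proof (induction W)
    case empty
    with assms(2) show ?case by (simp add: free_algebra_simps)
  next
    case (insert v W)
    let ?q = "\<lambda>w. if w \<in> W then p w else \<zero>"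
    have "{w. ?q w \<noteq> \<zero>} \<subseteq> {w. p w \<noteq> \<zero>}" by auto
    then have q: "?q \<in> carrier (free_algebra R)"
      using p by (auto simp: free_algebra_carrier_iff intro: finite_subset)
    have "P (monomial R (p v) v \<oplus>\<^bsub>free_algebra R\<^esub> ?q)"
      using insert p q by (intro add monom) auto
    also have "monomial R (p v) v \<oplus>\<^bsub>free_algebra R\<^esub> ?q = (\<lambda>w. if w \<in> insert v W then p w else \<zero>)"
      using insert.hyps p by (auto simp: free_algebra_simps monomial_def)
    finally show ?case .
  qed
  from this[OF p(2)] have "P (\<lambda>w. if p w \<noteq> \<zero> then p w else \<zero>)" by simp
  also have "(\<lambda>w. if p w \<noteq> \<zero> then p w else \<zero>) = p" by auto
  finally show ?thesis .
qed

lemma free_algebra_generates: "generates R (free_algebra R) (range (free_gen R))"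
  unfolding generates_def
proof (intro allI impI)
  interpret A: assoc_algebra R "free_algebra R" by (rule free_algebra_assoc_algebra)
  fix X assume X: "X \<subseteq> carrier (free_algebra R)" "\<one>\<^bsub>free_algebra R\<^esub> \<in> X"
    "\<forall>u\<in>X. \<forall>v\<in>X. u \<oplus>\<^bsub>free_algebra R\<^esub> v \<in> X"
    "\<forall>c\<in>carrier R. \<forall>u\<in>X. c \<odot>\<^bsub>free_algebra R\<^esub> u \<in> X"
    "\<forall>g\<in>range (free_gen R). \<forall>u\<in>X. g \<otimes>\<^bsub>free_algebra R\<^esub> u \<in> X"
  have monom: "monomial R c w \<in> X" if "c \<in> carrier R" for c w
  proof (induction w)
    case Nil
    with that X show ?case by (simp add: monomial_Nil)
  next
    case (Cons x w)
    with that X show ?case by (simp flip: free_gen_mult_monomial)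
  qed
  have zero: "\<zero>\<^bsub>free_algebra R\<^esub> \<in> X"
    using X(1,2,4) A.scalars.smult_l_null[OF A.one_closed] by (metis zero_closed)
  have "p \<in> X" if "p \<in> carrier (free_algebra R)" for p
    using that
  proof (induction rule: free_algebra_induct)
    case (monomial w)
    show ?case by (rule monom[OF free_algebra_coeff[OF that]])
  qed (use X zero in auto)
  with X(1) show "X = carrier (free_algebra R)" by blast
qed

end

section \<open>Evaluation of the free algebra at elements of an algebra\<close>

definition word_value :: "('f, 'a, 'k) module_scheme \<Rightarrow> ('x \<Rightarrow> 'a) \<Rightarrow> 'x list \<Rightarrow> 'a" where
  "word_value A g w = foldr (\<lambda>x u. g x \<otimes>\<^bsub>A\<^esub> u) w \<one>\<^bsub>A\<^esub>"

definition free_eval ::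
    "('f, 'm) ring_scheme \<Rightarrow> ('f, 'a, 'k) module_scheme \<Rightarrow> ('x \<Rightarrow> 'a) \<Rightarrow> ('x list \<Rightarrow> 'f) \<Rightarrow> 'a" where
  "free_eval F A g p = (\<Oplus>\<^bsub>A\<^esub>w\<in>{w. p w \<noteq> \<zero>\<^bsub>F\<^esub>}. p w \<odot>\<^bsub>A\<^esub> word_value A g w)"

context assoc_algebra
begin

lemma word_value_simps [simp]:
  "word_value A g [] = \<one>" "word_value A g (x # w) = g x \<otimes> word_value A g w"
  by (simp_all add: word_value_def)

lemma word_value_closed [simp]:
  "(\<And>x. g x \<in> carrier A) \<Longrightarrow> word_value A g w \<in> carrier A"
  by (induction w) auto

text \<open>Supports change under addition and scaling; summing over a common larger set makes such
  sums comparable term by term.\<close>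

lemma free_eval_superset:
  assumes "p \<in> carrier (free_algebra F)" "\<And>x. g x \<in> carrier A"
    and "finite W" "{w. p w \<noteq> \<zero>\<^bsub>F\<^esub>} \<subseteq> W"
  shows "free_eval F A g p = (\<Oplus>w\<in>W. p w \<odot> word_value A g w)"
  unfolding free_eval_def
  using assms scalars.R.free_algebra_coeff[OF assms(1)]
  by (intro add.finprod_mono_neutral_cong_left) auto

text \<open>The existence half of the universal property of the free algebra.\<close>

lemma free_eval_hom:
  assumes g: "\<And>x. g x \<in> carrier A"
  shows "free_eval F A g \<in> algebra_hom F (free_algebra F) A"
    and "free_eval F A g (free_gen F x) = g x"
proof -
  interpret free: assoc_algebra F "free_algebra F" by (rule scalars.R.free_algebra_assoc_algebra)
  let ?A = "free_algebra F" and ?e = "free_eval F A g" and ?v = "word_value A g"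
  let ?S = "\<lambda>p. {w. p w \<noteq> \<zero>\<^bsub>F\<^esub>}"
  note coeff = scalars.R.free_algebra_coeff
  note simps = scalars.R.free_algebra_simps
  have fin: "finite (?S p)" if "p \<in> carrier ?A" for p
    using that by (simp add: scalars.R.free_algebra_carrier_iff)
  have closed: "?e p \<in> carrier A" if "p \<in> carrier ?A" for p
    unfolding free_eval_def using that coeff[OF that] by (intro finsum_closed) (auto simp: g)
  have add: "?e (p \<oplus>\<^bsub>?A\<^esub> q) = ?e p \<oplus> ?e q" if pq: "p \<in> carrier ?A" "q \<in> carrier ?A" for p q
  proof -
    let ?W = "?S p \<union> ?S q"
    have sub: "?S (p \<oplus>\<^bsub>?A\<^esub> q) \<subseteq> ?W" by (auto simp: simps)
    have "?e (p \<oplus>\<^bsub>?A\<^esub> q) = (\<Oplus>w\<in>?W. p w \<odot> ?v w \<oplus> q w \<odot> ?v w)"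
      using pq coeff[OF pq(1)] coeff[OF pq(2)] fin sub free.a_closed[OF pq]
      by (subst free_eval_superset[where W = ?W])
        (auto simp: g simps scalars.smult_l_distr intro!: add.finprod_cong')
    also have "\<dots> = (\<Oplus>w\<in>?W. p w \<odot> ?v w) \<oplus> (\<Oplus>w\<in>?W. q w \<odot> ?v w)"
      using pq coeff[OF pq(1)] coeff[OF pq(2)] by (intro finsum_addf) (auto simp: g)
    also have "\<dots> = ?e p \<oplus> ?e q"
      using pq coeff[OF pq(1)] coeff[OF pq(2)] fin by (subst (1 2) free_eval_superset[where W = ?W]) (auto simp: g)
    finally show ?thesis .
  qed
  have smult: "?e (c \<odot>\<^bsub>?A\<^esub> p) = c \<odot> ?e p" if cp: "c \<in> carrier F" "p \<in> carrier ?A" for c p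
  proof -
    have sub: "?S (c \<odot>\<^bsub>?A\<^esub> p) \<subseteq> ?S p" using cp coeff[OF cp(2)] by (auto simp: simps)
    have "?e (c \<odot>\<^bsub>?A\<^esub> p) = (\<Oplus>w\<in>?S p. c \<odot> (p w \<odot> ?v w))"
      using cp coeff[OF cp(2)] fin sub free.scalars.smult_closed[OF cp]
      by (subst free_eval_superset[where W = "?S p"])
        (auto simp: g simps scalars.smult_assoc1 intro!: add.finprod_cong')
    also have "\<dots> = c \<odot> ?e p"
      unfolding free_eval_def using cp coeff[OF cp(2)]
      by (subst scalars.finsum_smult_ldistr) (auto simp: g fin)
    finally show ?thesis .
  qed
  have gen: "?e (free_gen F x \<otimes>\<^bsub>?A\<^esub> p) = g x \<otimes> ?e p" if p: "p \<in> carrier ?A" for x p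
  proof -
    let ?q = "free_gen F x \<otimes>\<^bsub>?A\<^esub> p"
    have q: "?q = (\<lambda>w. case w of [] \<Rightarrow> \<zero>\<^bsub>F\<^esub> | y # v \<Rightarrow> if y = x then p v else \<zero>\<^bsub>F\<^esub>)"
      using p by (rule scalars.R.free_gen_mult)
    \<comment> \<open>Prepending \<open>x\<close> is a bijection from the support of
      \<open>p\<close> to that of the product, along which the defining sum is reindexed.\<close>
    have "w \<in> ?S ?q \<longleftrightarrow> w \<in> (#) x ` ?S p" for w
      by (cases w) (auto simp: q)
    then have "?S ?q = (#) x ` ?S p" by blast
    then have "?e ?q = (\<Oplus>w\<in>(#) x ` ?S p. ?q w \<odot> ?v w)"
      unfolding free_eval_def by simp
    also have "\<dots> = (\<Oplus>w\<in>?S p. ?q (x # w) \<odot> ?v (x # w))"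
      using p coeff[OF free.m_closed[OF scalars.R.free_gen_closed p]]
      by (intro add.finprod_reindex) (auto simp: g)
    also have "\<dots> = (\<Oplus>w\<in>?S p. g x \<otimes> (p w \<odot> ?v w))"
      using p coeff[OF p] by (intro add.finprod_cong')
        (auto simp: q g smult_mult_right)
    also have "\<dots> = g x \<otimes> ?e p"
      unfolding free_eval_def using p coeff[OF p] by (subst finsum_rdistr) (auto simp: g fin)
    finally show ?thesis .
  qed
  have one: "?e \<one>\<^bsub>?A\<^esub> = \<one>"
  proof (cases "\<one>\<^bsub>F\<^esub> = \<zero>\<^bsub>F\<^esub>")
    \<comment> \<open>Over the zero ring the unit of the free algebra has empty support. Then
      \<open>A\<close> is trivial as well, because its unit equals 1 times itself and 0 times
      itself.\<close>
    case True
    then have "\<one> = \<zero>"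
      using scalars.smult_one[OF one_closed] scalars.smult_l_null[OF one_closed] by simp
    then show ?thesis using True by (simp add: free_eval_def simps)
  next
    case False
    have "?e \<one>\<^bsub>?A\<^esub> = (\<Oplus>w\<in>{[]}. \<one>\<^bsub>?A\<^esub> w \<odot> ?v w)"
      by (rule free_eval_superset) (use free.one_closed in \<open>auto simp: g simps\<close>)
    then show ?thesis by (simp add: simps)
  qed
  \<comment> \<open>Multiplicativity for a single generator on the left is \<open>gen\<close>;
    induction along the generators extends it to every left factor.\<close>
  have mult: "?e (p \<otimes>\<^bsub>?A\<^esub> q) = ?e p \<otimes> ?e q" if "p \<in> carrier ?A" "q \<in> carrier ?A" for p q
    using scalars.R.free_algebra_generates that(1)
  proof (induction rule: generates_induct)
    case (mult h u)
    then obtain x where h: "h = free_gen F x" by blast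
    have "?e (h \<otimes>\<^bsub>?A\<^esub> u \<otimes>\<^bsub>?A\<^esub> q) = g x \<otimes> ?e (u \<otimes>\<^bsub>?A\<^esub> q)"
      using mult that(2) by (simp add: h free.m_assoc gen)
    with mult that(2) show ?case by (simp add: h gen m_assoc closed g)
  qed (use that(2) in \<open>auto simp: one closed add smult free.l_distr l_distr free.smult_mult_left
      smult_mult_left free.assoc_algebra_axioms\<close>)
  show "?e \<in> algebra_hom F ?A A"
    by (auto simp: algebra_hom_def ring_hom_def closed add smult mult one)
  have "?e (free_gen F x) = ?e (free_gen F x \<otimes>\<^bsub>?A\<^esub> \<one>\<^bsub>?A\<^esub>)" by simp
  also have "\<dots> = g x" by (subst gen) (simp_all add: one g)
  finally show "?e (free_gen F x) = g x" .
qed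

end

section \<open>Quotients and presentations\<close>

context assoc_algebra
begin

text \<open>\<open>B\<close> is only a record here: a surjection from \<open>A\<close> that respects
  the operations transports all axioms to it.\<close>

lemma assoc_algebra_image:
  fixes B :: "('f, 'b, 'l) module_scheme"
  assumes h: "h ` carrier A = carrier B"
    and ops: "h \<one> = \<one>\<^bsub>B\<^esub>" "h \<zero> = \<zero>\<^bsub>B\<^esub>"
      "\<And>u v. \<lbrakk>u \<in> carrier A; v \<in> carrier A\<rbrakk> \<Longrightarrow> h u \<oplus>\<^bsub>B\<^esub> h v = h (u \<oplus> v)"
      "\<And>u v. \<lbrakk>u \<in> carrier A; v \<in> carrier A\<rbrakk> \<Longrightarrow> h u \<otimes>\<^bsub>B\<^esub> h v = h (u \<otimes> v)"
      "\<And>c u. \<lbrakk>c \<in> carrier F; u \<in> carrier A\<rbrakk> \<Longrightarrow> c \<odot>\<^bsub>B\<^esub> h u = h (c \<odot> u)"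
  shows "assoc_algebra F B"
  by (rule assoc_algebraI, unfold h[symmetric])
    (auto simp: ops scalars.R.is_cring a_ac m_assoc l_distr r_distr scalars.smult_l_distr
      scalars.smult_r_distr scalars.smult_assoc1 smult_mult_left smult_mult_right
      simp flip: ops(1,2))

text \<open>The union in \<open>quot_algebra\<close> ranges over all representatives. Two of them
  differ by some \<open>j\<close> in \<open>J\<close>, and c j lies in \<open>J\<close> again, so
  every member of the union is the same coset.\<close>

lemma quot_algebra_smult:
  assumes J: "ideal J A" and cu: "c \<in> carrier F" "u \<in> carrier A"
  shows "c \<odot>\<^bsub>quot_algebra A J\<^esub> (J +> u) = J +> (c \<odot> u)"
proof -
  interpret J: ideal J A by fact
  have eq: "J +> (c \<odot> v) = J +> (c \<odot> u)" if v: "v \<in> J +> u" for v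
  proof -
    obtain j where j: "j \<in> J" "v = j \<oplus> u"
      using v by (auto simp: a_r_coset_def r_coset_def)
    then have jA: "j \<in> carrier A" using J.a_subset by blast
    have "c \<odot> v = c \<odot> j \<oplus> c \<odot> u"
      using j jA cu by (simp add: scalars.smult_r_distr)
    moreover have "c \<odot> j \<in> J" using J cu(1) j(1) by (rule ideal_smult_closed)
    ultimately have "c \<odot> v \<in> J +> (c \<odot> u)"
      using J.a_subset cu by (simp add: a_rcosI)
    then show ?thesis
      using a_repr_independence[of "c \<odot> v" J "c \<odot> u"] cu J.a_subgroup by simp
  qed
  have "(\<Union>v\<in>J +> u. J +> (c \<odot> v)) = (\<Union>v\<in>J +> u. J +> (c \<odot> u))"
    by (intro SUP_cong refl eq)
  also have "\<dots> = J +> (c \<odot> u)"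
    using J.a_rcos_self[OF cu(2)] by blast
  finally show ?thesis by (simp add: quot_algebra_def)
qed

lemma quot_algebra_simps:
  assumes J: "ideal J A"
  shows "(+>) J ` carrier A = carrier (quot_algebra A J)"
    and "J +> \<one> = \<one>\<^bsub>quot_algebra A J\<^esub>" "J +> \<zero> = \<zero>\<^bsub>quot_algebra A J\<^esub>"
    and "\<lbrakk>u \<in> carrier A; v \<in> carrier A\<rbrakk>
      \<Longrightarrow> (J +> u) \<oplus>\<^bsub>quot_algebra A J\<^esub> (J +> v) = J +> (u \<oplus> v)"
    and "\<lbrakk>u \<in> carrier A; v \<in> carrier A\<rbrakk>
      \<Longrightarrow> (J +> u) \<otimes>\<^bsub>quot_algebra A J\<^esub> (J +> v) = J +> (u \<otimes> v)"
proof -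
  interpret J: ideal J A by fact
  note hom = J.rcos_ring_hom
  show "(+>) J ` carrier A = carrier (quot_algebra A J)"
    by (auto simp: quot_algebra_def FactRing_def A_RCOSETS_def')
  show "J +> \<one> = \<one>\<^bsub>quot_algebra A J\<^esub>"
    using ring_hom_one[OF hom] by (simp add: quot_algebra_def)
  show "J +> \<zero> = \<zero>\<^bsub>quot_algebra A J\<^esub>"
    using ring_hom_zero[OF hom ring_axioms J.quotient_is_ring] by (simp add: quot_algebra_def)
  show "(J +> u) \<oplus>\<^bsub>quot_algebra A J\<^esub> (J +> v) = J +> (u \<oplus> v)"
    if "u \<in> carrier A" "v \<in> carrier A"
    using ring_hom_add[OF hom that] by (simp add: quot_algebra_def)
  show "(J +> u) \<otimes>\<^bsub>quot_algebra A J\<^esub> (J +> v) = J +> (u \<otimes> v)"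
    if "u \<in> carrier A" "v \<in> carrier A"
    using ring_hom_mult[OF hom that] by (simp add: quot_algebra_def)
qed

lemma quot_algebra_assoc_algebra:
  assumes "ideal J A"
  shows "assoc_algebra F (quot_algebra A J)"
  by (rule assoc_algebra_image[of "(+>) J"])
    (fact quot_algebra_simps[OF assms] quot_algebra_smult[OF assms])+

lemma quot_algebra_hom:
  assumes "ideal J A"
  shows "(+>) J \<in> algebra_hom F A (quot_algebra A J)"
  unfolding algebra_hom_def ring_hom_def quot_algebra_simps(1)[OF assms, symmetric]
  by (simp add: quot_algebra_simps(2,4,5)[OF assms] quot_algebra_smult[OF assms])

lemma quot_algebra_zero_iff:
  assumes "ideal J A" "u \<in> carrier A"
  shows "J +> u = \<zero>\<^bsub>quot_algebra A J\<^esub> \<longleftrightarrow> u \<in> J"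
proof -
  interpret J: ideal J A by fact
  show ?thesis
    using J.a_rcos_const[of u] J.a_rcos_self[OF assms(2)]
    by (auto simp: quot_algebra_def FactRing_def)
qed

lemma quot_algebra_lift:
  fixes B :: "('f, 'b, 'l) module_scheme"
  assumes J: "ideal J A" and B: "assoc_algebra F B" and g: "g \<in> algebra_hom F A B"
    and ker: "\<And>u. u \<in> J \<Longrightarrow> g u = \<zero>\<^bsub>B\<^esub>"
  obtains h where "h \<in> algebra_hom F (quot_algebra A J) B" "\<And>u. u \<in> carrier A \<Longrightarrow> h (J +> u) = g u"
proof
  interpret J: ideal J A by fact
  interpret B: assoc_algebra F B by fact
  note g_hom = algebra_homD[OF g]
  \<comment> \<open>As \<open>g\<close> vanishes on \<open>J\<close>, it is constant on each coset;
    the image of a coset is a singleton, whose element is the value of the induced map.\<close>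
  let ?h = "\<lambda>U. the_elem (g ` U)"
  show h: "?h (J +> u) = g u" if u: "u \<in> carrier A" for u
  proof -
    have eq: "g v = g u" if v: "v \<in> J +> u" for v
    proof -
      obtain j where j: "j \<in> J" "v = j \<oplus> u"
        using v by (auto simp: a_r_coset_def r_coset_def)
      then have "j \<in> carrier A" using J.a_subset by blast
      with j u show ?thesis by (simp add: g_hom ker)
    qed
    have "g ` (J +> u) = (\<lambda>_. g u) ` (J +> u)" by (intro image_cong refl eq)
    also have "\<dots> = {g u}" using J.a_rcos_self[OF u] by blast
    finally show ?thesis by simp
  qed
  note simps = h g_hom quot_algebra_smult[OF J] quot_algebra_simps(4,5)[OF J]
  have "?h \<one>\<^bsub>quot_algebra A J\<^esub> = \<one>\<^bsub>B\<^esub>"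
    unfolding quot_algebra_simps(2)[OF J, symmetric] by (simp add: simps)
  then show "?h \<in> algebra_hom F (quot_algebra A J) B"
    unfolding algebra_hom_def ring_hom_def quot_algebra_simps(1)[OF J, symmetric]
    by (auto simp: simps)
qed

end

lemma (in cring) presented_algebra_facts:
  assumes rels: "rels \<subseteq> carrier (free_algebra R)"
  defines "\<pi> \<equiv> \<lambda>p. (Idl\<^bsub>free_algebra R\<^esub> rels) +>\<^bsub>free_algebra R\<^esub> p"
  shows "assoc_algebra R (presented_algebra R rels)"
    and "\<pi> \<in> algebra_hom R (free_algebra R) (presented_algebra R rels)"
    and "\<pi> ` carrier (free_algebra R) = carrier (presented_algebra R rels)"
    and "\<And>p. p \<in> carrier (free_algebra R)
      \<Longrightarrow> \<pi> p = \<zero>\<^bsub>presented_algebra R rels\<^esub> \<longleftrightarrow> p \<in> Idl\<^bsub>free_algebra R\<^esub> rels"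
    and "\<pi> (free_gen R x) = presented_gen R rels x"
    and "presented_gen R rels x \<in> carrier (presented_algebra R rels)"
    and "generates R (presented_algebra R rels) (range (presented_gen R rels))"
proof -
  interpret A: assoc_algebra R "free_algebra R" by (rule free_algebra_assoc_algebra)
  have J: "ideal (Idl\<^bsub>free_algebra R\<^esub> rels) (free_algebra R)"
    using rels by (rule A.genideal_ideal)
  show "assoc_algebra R (presented_algebra R rels)"
    unfolding presented_algebra_def by (rule A.quot_algebra_assoc_algebra[OF J])
  show hom: "\<pi> \<in> algebra_hom R (free_algebra R) (presented_algebra R rels)"
    unfolding presented_algebra_def \<pi>_def by (rule A.quot_algebra_hom[OF J])
  show img: "\<pi> ` carrier (free_algebra R) = carrier (presented_algebra R rels)"
    unfolding presented_algebra_def \<pi>_def by (rule A.quot_algebra_simps(1)[OF J])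
  show "\<pi> p = \<zero>\<^bsub>presented_algebra R rels\<^esub> \<longleftrightarrow> p \<in> Idl\<^bsub>free_algebra R\<^esub> rels"
    if "p \<in> carrier (free_algebra R)" for p
    unfolding presented_algebra_def \<pi>_def by (rule A.quot_algebra_zero_iff[OF J that])
  show gen: "\<pi> (free_gen R x) = presented_gen R rels x" for x
    by (simp add: \<pi>_def presented_gen_def)
  show "presented_gen R rels x \<in> carrier (presented_algebra R rels)"
    unfolding img[symmetric] gen[symmetric] by simp
  have "generates R (presented_algebra R rels) (\<pi> ` range (free_gen R))"
    using A.assoc_algebra_axioms hom img free_algebra_generates
    by (rule generates_image) auto
  then show "generates R (presented_algebra R rels) (range (presented_gen R rels))"
    by (simp add: image_image gen)
qed

text \<open>The universal property of a presentation. The kernel of the evaluation is an ideal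
  containing \<open>rels\<close>, hence contains the ideal they generate, and the evaluation
  descends to the quotient.\<close>

lemma (in cring) presented_algebra_lift:
  assumes rels: "rels \<subseteq> carrier (free_algebra R)"
    and B: "assoc_algebra R B" and g: "\<And>x. g x \<in> carrier B"
    and zero: "\<And>p. p \<in> rels \<Longrightarrow> free_eval R B g p = \<zero>\<^bsub>B\<^esub>"
  obtains h where "h \<in> algebra_hom R (presented_algebra R rels) B"
    "\<And>x. h (presented_gen R rels x) = g x"
proof -
  interpret A: assoc_algebra R "free_algebra R" by (rule free_algebra_assoc_algebra)
  interpret B: assoc_algebra R B by fact
  note eval = B.free_eval_hom[of g, OF g]
  let ?J = "Idl\<^bsub>free_algebra R\<^esub> rels"
  have "?J \<subseteq> a_kernel (free_algebra R) B (free_eval R B g)"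
    using algebra_hom_kernel[OF A.assoc_algebra_axioms B eval(1)] rels zero
    by (intro A.genideal_minimal) (auto simp: a_kernel_def')
  then have "\<And>p. p \<in> ?J \<Longrightarrow> free_eval R B g p = \<zero>\<^bsub>B\<^esub>"
    by (auto simp: a_kernel_def')
  then obtain h where "h \<in> algebra_hom R (quot_algebra (free_algebra R) ?J) B"
    "\<And>p. p \<in> carrier (free_algebra R) \<Longrightarrow> h (?J +>\<^bsub>free_algebra R\<^esub> p) = free_eval R B g p"
    using A.quot_algebra_lift[OF A.genideal_ideal[OF rels] B eval(1)] by blast
  then show thesis
    by (intro that[of h]) (simp_all add: presented_algebra_def presented_gen_def eval)
qed

section \<open>Corners and matrix algebras\<close>

text \<open>For an idempotent \<open>e\<close> this is the Peirce corner e A e, described as the set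
  of elements that \<open>e\<close> fixes on both sides.\<close>

definition corner :: "('f, 'a, 'k) module_scheme \<Rightarrow> 'a \<Rightarrow> ('f, 'a, 'k) module_scheme" where
  "corner A e = A\<lparr>carrier := {u \<in> carrier A. e \<otimes>\<^bsub>A\<^esub> u = u \<and> u \<otimes>\<^bsub>A\<^esub> e = u}, one := e\<rparr>"

lemma corner_simps [simp]:
  "carrier (corner A e) = {u \<in> carrier A. e \<otimes>\<^bsub>A\<^esub> u = u \<and> u \<otimes>\<^bsub>A\<^esub> e = u}"
  "\<one>\<^bsub>corner A e\<^esub> = e" "\<zero>\<^bsub>corner A e\<^esub> = \<zero>\<^bsub>A\<^esub>" "mult (corner A e) = mult A"
  "add (corner A e) = add A" "smult (corner A e) = smult A"
  by (simp_all add: corner_def)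

context assoc_algebra
begin

lemma mat2_simps [simp]:
  "Mat2 p q r s \<in> carrier (mat2_algebra A)
    \<longleftrightarrow> p \<in> carrier A \<and> q \<in> carrier A \<and> r \<in> carrier A \<and> s \<in> carrier A"
  "\<one>\<^bsub>mat2_algebra A\<^esub> = Mat2 \<one> \<zero> \<zero> \<one>"
  "\<zero>\<^bsub>mat2_algebra A\<^esub> = Mat2 \<zero> \<zero> \<zero> \<zero>"
  "Mat2 p q r s \<oplus>\<^bsub>mat2_algebra A\<^esub> Mat2 p' q' r' s' = Mat2 (p \<oplus> p') (q \<oplus> q') (r \<oplus> r') (s \<oplus> s')"
  "Mat2 p q r s \<otimes>\<^bsub>mat2_algebra A\<^esub> Mat2 p' q' r' s' = Mat2
    (p \<otimes> p' \<oplus> q \<otimes> r') (p \<otimes> q' \<oplus> q \<otimes> s') (r \<otimes> p' \<oplus> s \<otimes> r') (r \<otimes> q' \<oplus> s \<otimes> s')"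
  "c \<odot>\<^bsub>mat2_algebra A\<^esub> Mat2 p q r s = Mat2 (c \<odot> p) (c \<odot> q) (c \<odot> r) (c \<odot> s)"
  by (auto simp: mat2_algebra_def)

lemma mat2_carrierE:
  assumes "M \<in> carrier (mat2_algebra A)"
  obtains p q r s where "M = Mat2 p q r s"
    "p \<in> carrier A" "q \<in> carrier A" "r \<in> carrier A" "s \<in> carrier A"
  using assms by (cases M) auto

lemma mat2_assoc_algebra: "assoc_algebra F (mat2_algebra A)"
  by (rule assoc_algebraI)
    (auto elim!: mat2_carrierE simp: scalars.R.is_cring a_ac m_assoc l_distr r_distr
      scalars.smult_l_distr scalars.smult_r_distr scalars.smult_assoc1
      smult_mult_left smult_mult_right)

lemma corner_assoc_algebra:
  assumes "e \<in> carrier A" "e \<otimes> e = e"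
  shows "assoc_algebra F (corner A e)"
proof (rule assoc_subalgebra)
  fix u v assume uv: "u \<in> carrier (corner A e)" "v \<in> carrier (corner A e)"
  then show "u \<otimes> v \<in> carrier (corner A e)"
    using m_assoc[of e u v] m_assoc[of u v e] assms(1) by simp
qed (use assms in \<open>auto simp: l_distr r_distr smult_mult_left smult_mult_right\<close>)

section \<open>The left ideal \<open>I\<close> and the algebra \<open>T\<close>\<close>

context
  fixes a b
  assumes ab: "a \<in> carrier A" "b \<in> carrier A"
begin

lemma I_ideal_closed:
  "i \<in> I_ideal A a b \<Longrightarrow> i \<in> carrier A"
  "\<zero> \<in> I_ideal A a b"
  "\<lbrakk>i \<in> I_ideal A a b; j \<in> I_ideal A a b\<rbrakk> \<Longrightarrow> i \<oplus> j \<in> I_ideal A a b"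
  "\<lbrakk>r \<in> carrier A; i \<in> I_ideal A a b\<rbrakk> \<Longrightarrow> r \<otimes> i \<in> I_ideal A a b"
  "\<lbrakk>c \<in> carrier F; i \<in> I_ideal A a b\<rbrakk> \<Longrightarrow> c \<odot> i \<in> I_ideal A a b"
proof -
  let ?d = "\<one> \<ominus> b \<otimes> a"
  have d: "?d \<in> carrier A" using ab by simp
  have mem: "r \<otimes> ?d \<in> I_ideal A a b" if "r \<in> carrier A" for r
    using that by (auto simp: I_ideal_def)
  show "i \<in> I_ideal A a b \<Longrightarrow> i \<in> carrier A"
    using d by (auto simp: I_ideal_def)
  show "\<zero> \<in> I_ideal A a b"
    using mem[of \<zero>] d by simp
  show "i \<oplus> j \<in> I_ideal A a b" if "i \<in> I_ideal A a b" "j \<in> I_ideal A a b"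
  proof -
    from that obtain r s where "i = r \<otimes> ?d" "j = s \<otimes> ?d" "r \<in> carrier A" "s \<in> carrier A"
      by (auto simp: I_ideal_def)
    then show ?thesis using mem[of "r \<oplus> s"] d by (simp add: l_distr)
  qed
  show "r \<otimes> i \<in> I_ideal A a b" if "r \<in> carrier A" "i \<in> I_ideal A a b"
  proof -
    from that obtain s where "i = s \<otimes> ?d" "s \<in> carrier A"
      by (auto simp: I_ideal_def)
    then show ?thesis using mem[of "r \<otimes> s"] d that by (simp add: m_assoc)
  qed
  show "c \<odot> i \<in> I_ideal A a b" if "c \<in> carrier F" "i \<in> I_ideal A a b"
  proof -
    from that obtain s where "i = s \<otimes> ?d" "s \<in> carrier A"
      by (auto simp: I_ideal_def)
    then show ?thesis using mem[of "c \<odot> s"] d that by (simp add: smult_mult_left)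
  qed
qed

lemma scalars_plus_I_memI:
  "\<lbrakk>c \<in> carrier F; i \<in> I_ideal A a b\<rbrakk> \<Longrightarrow> c \<odot> \<one> \<oplus> i \<in> scalars_plus_I F A a b"
  by (auto simp: scalars_plus_I_def)

text \<open>Scalars are central and \<open>I\<close> is a left ideal, so I F and I I both lie in
  \<open>I\<close>. This makes \<open>I\<close> a right module over F1 + I, as the upper right entry
  of a product in \<open>T\<close> demands.\<close>

lemma I_ideal_mult_scalars_plus_I:
  assumes "i \<in> I_ideal A a b" "t \<in> scalars_plus_I F A a b"
  shows "i \<otimes> t \<in> I_ideal A a b"
proof -
  from assms obtain c j where "t = c \<odot> \<one> \<oplus> j" "c \<in> carrier F" "j \<in> I_ideal A a b"
    by (auto simp: scalars_plus_I_def)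
  then show ?thesis
    using assms(1) by (simp add: I_ideal_closed r_distr smult_mult_right)
qed

lemma I_ideal_subset: "i \<in> I_ideal A a b \<Longrightarrow> i \<in> scalars_plus_I F A a b"
  using scalars_plus_I_memI[of "\<zero>\<^bsub>F\<^esub>" i] by (simp add: I_ideal_closed)

lemma scalars_plus_I_closed:
  "t \<in> scalars_plus_I F A a b \<Longrightarrow> t \<in> carrier A"
  "\<one> \<in> scalars_plus_I F A a b"
  "\<lbrakk>t \<in> scalars_plus_I F A a b; t' \<in> scalars_plus_I F A a b\<rbrakk> \<Longrightarrow> t \<oplus> t' \<in> scalars_plus_I F A a b"
  "\<lbrakk>t \<in> scalars_plus_I F A a b; t' \<in> scalars_plus_I F A a b\<rbrakk> \<Longrightarrow> t \<otimes> t' \<in> scalars_plus_I F A a b"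
  "\<lbrakk>c \<in> carrier F; t \<in> scalars_plus_I F A a b\<rbrakk> \<Longrightarrow> c \<odot> t \<in> scalars_plus_I F A a b"
proof -
  show closed: "t \<in> carrier A" if "t \<in> scalars_plus_I F A a b" for t
    using that by (auto simp: scalars_plus_I_def I_ideal_closed)
  show "\<one> \<in> scalars_plus_I F A a b"
    using scalars_plus_I_memI[of "\<one>\<^bsub>F\<^esub>" \<zero>] by (simp add: I_ideal_closed)
  show add: "t \<oplus> t' \<in> scalars_plus_I F A a b"
    if "t \<in> scalars_plus_I F A a b" "t' \<in> scalars_plus_I F A a b" for t t'
  proof -
    from that obtain c i c' i' where *: "t = c \<odot> \<one> \<oplus> i" "c \<in> carrier F" "i \<in> I_ideal A a b"
      "t' = c' \<odot> \<one> \<oplus> i'" "c' \<in> carrier F" "i' \<in> I_ideal A a b"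
      by (auto simp: scalars_plus_I_def)
    have "t \<oplus> t' = (c \<oplus>\<^bsub>F\<^esub> c') \<odot> \<one> \<oplus> (i \<oplus> i')"
      using * by (simp add: I_ideal_closed scalars.smult_l_distr a_ac)
    also have "\<dots> \<in> scalars_plus_I F A a b"
      using * by (intro scalars_plus_I_memI I_ideal_closed) auto
    finally show ?thesis .
  qed
  show smult: "c \<odot> t \<in> scalars_plus_I F A a b"
    if "c \<in> carrier F" "t \<in> scalars_plus_I F A a b" for c t
  proof -
    from that obtain d i where *: "t = d \<odot> \<one> \<oplus> i" "d \<in> carrier F" "i \<in> I_ideal A a b"
      by (auto simp: scalars_plus_I_def)
    have "c \<odot> t = (c \<otimes>\<^bsub>F\<^esub> d) \<odot> \<one> \<oplus> c \<odot> i"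
      using * that by (simp add: I_ideal_closed scalars.smult_r_distr scalars.smult_assoc1)
    also have "\<dots> \<in> scalars_plus_I F A a b"
      using * that by (intro scalars_plus_I_memI I_ideal_closed) auto
    finally show ?thesis .
  qed
  show "t \<otimes> t' \<in> scalars_plus_I F A a b"
    if "t \<in> scalars_plus_I F A a b" "t' \<in> scalars_plus_I F A a b"
  proof -
    from that obtain c i where *: "t = c \<odot> \<one> \<oplus> i" "c \<in> carrier F" "i \<in> I_ideal A a b"
      by (auto simp: scalars_plus_I_def)
    have "t \<otimes> t' = c \<odot> t' \<oplus> i \<otimes> t'"
      using * that by (simp add: I_ideal_closed closed l_distr scalar_mult)
    then show ?thesis
      using * that by (simp add: add smult I_ideal_subset I_ideal_mult_scalars_plus_I)
  qed
qed

lemma T_algebra_simps [simp]: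
  "Mat2 r i s t \<in> carrier (T_algebra F A a b)
    \<longleftrightarrow> r \<in> carrier A \<and> i \<in> I_ideal A a b \<and> s \<in> carrier A \<and> t \<in> scalars_plus_I F A a b"
  "\<one>\<^bsub>T_algebra F A a b\<^esub> = \<one>\<^bsub>mat2_algebra A\<^esub>" "\<zero>\<^bsub>T_algebra F A a b\<^esub> = \<zero>\<^bsub>mat2_algebra A\<^esub>"
  "mult (T_algebra F A a b) = mult (mat2_algebra A)" "add (T_algebra F A a b) = add (mat2_algebra A)"
  "smult (T_algebra F A a b) = smult (mat2_algebra A)"
  by (auto simp: T_algebra_def)

lemma T_algebra_carrierE:
  assumes "M \<in> carrier (T_algebra F A a b)"
  obtains r i s t where "M = Mat2 r i s t" "r \<in> carrier A" "i \<in> I_ideal A a b" "s \<in> carrier A"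
    "t \<in> scalars_plus_I F A a b"
  using assms by (cases M) auto

text \<open>The critical entries of a product are r i' + i t' in \<open>I\<close>, and s i' + t t'
  in F1 + I; the first column may be arbitrary.\<close>

lemma T_algebra_assoc_algebra: "assoc_algebra F (T_algebra F A a b)"
proof -
  interpret M: assoc_algebra F "mat2_algebra A" by (rule mat2_assoc_algebra)
  show ?thesis
    by (rule M.assoc_subalgebra)
      (auto elim!: T_algebra_carrierE simp: I_ideal_closed scalars_plus_I_closed I_ideal_subset
        I_ideal_mult_scalars_plus_I)
qed

lemma Q_mat_closed: "Q_mat A a b \<in> carrier (T_algebra F A a b)"
  and X_mat_closed: "X_mat A a \<in> carrier (T_algebra F A a b)"
proof -
  have "\<one> \<otimes> (\<one> \<ominus> b \<otimes> a) \<in> I_ideal A a b" by (auto simp: I_ideal_def)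
  then show "Q_mat A a b \<in> carrier (T_algebra F A a b)"
    using ab by (simp add: Q_mat_def I_ideal_closed I_ideal_subset)
  show "X_mat A a \<in> carrier (T_algebra F A a b)"
    using ab by (simp add: X_mat_def I_ideal_closed I_ideal_subset)
qed

text \<open>Negation in a record is defined through its own carrier. Rewriting it as multiplication
  by -1 makes it entrywise, since the scalar action of \<open>T\<close> is that of the
  matrices.\<close>

lemma T_algebra_minus:
  assumes "Mat2 r i s t \<in> carrier (T_algebra F A a b)" "Mat2 r' i' s' t' \<in> carrier (T_algebra F A a b)"
  shows "Mat2 r i s t \<ominus>\<^bsub>T_algebra F A a b\<^esub> Mat2 r' i' s' t'
    = Mat2 (r \<ominus> r') (i \<ominus> i') (s \<ominus> s') (t \<ominus> t')"
proof -
  interpret T: assoc_algebra F "T_algebra F A a b" by (rule T_algebra_assoc_algebra)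
  have "i' \<in> carrier A" "t' \<in> carrier A" using assms by (auto simp: I_ideal_closed scalars_plus_I_closed)
  then show ?thesis
    using assms T.minus_eq_smult[OF assms(2)] by (simp add: a_minus_def minus_eq_smult)
qed

end

end

section \<open>Peirce decomposition\<close>

lemma (in ring) minus_eq_zero_iff:
  assumes "u \<in> carrier R" "v \<in> carrier R"
  shows "u \<ominus> v = \<zero> \<longleftrightarrow> u = v"
proof -
  have "u = (u \<ominus> v) \<oplus> v" using assms by (simp add: a_minus_def a_assoc l_neg)
  then show ?thesis using assms by (metis a_minus_def l_zero r_neg)
qed

lemma (in ring) diff_zero_right: "u \<in> carrier R \<Longrightarrow> u \<ominus> \<zero> = u"
  by (simp add: a_minus_def)

text \<open>The common setting of both cases: \<open>S\<close> is any algebra generated by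
  \<open>q\<close> and \<open>x\<close> subject at least to the two relations, and
  \<open>\<phi>\<close> is the map from \<open>R\<close> to the corner at e = q x. Products are
  bracketed to the right to match rewriting with \<open>m_assoc\<close>.\<close>

locale corner_hom = assoc_algebra F S + R: assoc_algebra F R
  for F :: "('f, 'm) ring_scheme" and S :: "('f, 's, 'k) module_scheme" (structure)
    and R :: "('f, 'r, 'l) module_scheme" +
  fixes q x :: 's and a b :: 'r and \<phi> :: "'r \<Rightarrow> 's"
  assumes qx_closed [simp]: "q \<in> carrier S" "x \<in> carrier S"
    and ab_closed [simp]: "a \<in> carrier R" "b \<in> carrier R"
    and qxq: "q \<otimes> (x \<otimes> q) = q" and xqx: "x \<otimes> (q \<otimes> x) = x"
    and phi_hom: "\<phi> \<in> algebra_hom F R (corner S (q \<otimes> x))"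
    and phi_a: "\<phi> a = q \<otimes> (x \<otimes> x)" and phi_b: "\<phi> b = q \<otimes> (q \<otimes> x)"
    and generates_S: "generates F S {q, x}" and generates_R: "generates F R {a, b}"
begin

text \<open>With e = q x, \<open>f\<close> is the complementary idempotent 1 - e, \<open>y\<close>
  is f x and \<open>z\<close> is q f. In \<open>T\<close> they become E22, E21 and d E12, where Eij
  are the matrix units.\<close>

definition d :: 'r where "d = \<one>\<^bsub>R\<^esub> \<ominus>\<^bsub>R\<^esub> b \<otimes>\<^bsub>R\<^esub> a"
definition f :: 's where "f = \<one> \<ominus> q \<otimes> x"
definition y :: 's where "y = x \<ominus> q \<otimes> (x \<otimes> x)"
definition z :: 's where "z = q \<ominus> q \<otimes> (q \<otimes> x)"

lemma dfyz_closed [simp]: "d \<in> carrier R" "f \<in> carrier S" "y \<in> carrier S" "z \<in> carrier S"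
  by (simp_all add: d_def f_def y_def z_def)

lemma phi_closed [simp]: "r \<in> carrier R \<Longrightarrow> \<phi> r \<in> carrier S"
  using algebra_homD(1)[OF phi_hom] by simp

lemma phi_simps [simp]:
  "\<lbrakk>r \<in> carrier R; s \<in> carrier R\<rbrakk> \<Longrightarrow> \<phi> (r \<oplus>\<^bsub>R\<^esub> s) = \<phi> r \<oplus> \<phi> s"
  "\<lbrakk>r \<in> carrier R; s \<in> carrier R\<rbrakk> \<Longrightarrow> \<phi> (r \<otimes>\<^bsub>R\<^esub> s) = \<phi> r \<otimes> \<phi> s"
  "\<phi> \<one>\<^bsub>R\<^esub> = q \<otimes> x"
  "\<lbrakk>c \<in> carrier F; r \<in> carrier R\<rbrakk> \<Longrightarrow> \<phi> (c \<odot>\<^bsub>R\<^esub> r) = c \<odot> \<phi> r"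
  using algebra_homD[OF phi_hom] by simp_all

lemma e_idem: "q \<otimes> x \<otimes> (q \<otimes> x) = q \<otimes> x"
  using xqx by (simp add: m_assoc)

lemma phi_zero [simp]: "\<phi> \<zero>\<^bsub>R\<^esub> = \<zero>"
  using algebra_hom_zero[OF R.assoc_algebra_axioms corner_assoc_algebra phi_hom] e_idem by simp

lemma phi_minus:
  "\<lbrakk>r \<in> carrier R; s \<in> carrier R\<rbrakk> \<Longrightarrow> \<phi> (r \<ominus>\<^bsub>R\<^esub> s) = \<phi> r \<ominus> \<phi> s"
  by (simp add: a_minus_def a_minus_def minus_eq_smult R.minus_eq_smult)

lemma e_phi: "r \<in> carrier R \<Longrightarrow> q \<otimes> x \<otimes> \<phi> r = \<phi> r"
  using algebra_homD(1)[OF phi_hom] by simp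

lemma minus_r_distr:
  "\<lbrakk>u \<in> carrier S; v \<in> carrier S; w \<in> carrier S\<rbrakk> \<Longrightarrow> u \<otimes> (v \<ominus> w) = u \<otimes> v \<ominus> u \<otimes> w"
  by (simp add: a_minus_def r_distr r_minus)

text \<open>In a word bracketed to the right the factor x q x is followed by a tail, so the relation
  is also needed in this form.\<close>

lemma xqx_left: "u \<in> carrier S \<Longrightarrow> x \<otimes> (q \<otimes> (x \<otimes> u)) = x \<otimes> u"
  using arg_cong[OF xqx, of "\<lambda>v. v \<otimes> u"] by (simp add: m_assoc)

lemma qxq_left: "u \<in> carrier S \<Longrightarrow> q \<otimes> (x \<otimes> (q \<otimes> u)) = q \<otimes> u"
  using arg_cong[OF qxq, of "\<lambda>v. v \<otimes> u"] by (simp add: m_assoc)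

lemma q_f: "q \<otimes> f = z"
  by (simp add: f_def z_def minus_r_distr)

lemma x_f: "x \<otimes> f = \<zero>"
  by (simp add: f_def minus_r_distr xqx minus_eq_zero_iff)

lemma x_y: "x \<otimes> y = \<zero>"
  by (simp add: y_def minus_r_distr xqx_left minus_eq_zero_iff)

text \<open>The source of the factor 1 - ba: q y = q x - q q x x, where q x is \<open>\<phi>\<close>
  of the unit, and \<open>\<phi> b \<otimes> \<phi> a\<close> collapses to q q x x by x q x =
  x.\<close>

lemma q_y: "q \<otimes> y = \<phi> d"
  by (simp add: y_def d_def minus_r_distr phi_minus phi_a phi_b m_assoc xqx_left)

lemma e_z: "q \<otimes> x \<otimes> z = z"
  by (simp add: z_def minus_r_distr m_assoc qxq qxq_left)

lemma x_eq: "x = \<phi> a \<oplus> y"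
  by (simp add: phi_a y_def a_minus_def a_lcomm r_neg)

lemma q_phi: "r \<in> carrier R \<Longrightarrow> q \<otimes> \<phi> r = \<phi> (b \<otimes>\<^bsub>R\<^esub> r)"
  using e_phi[of r] by (simp add: phi_b m_assoc)

lemma x_phi: "r \<in> carrier R \<Longrightarrow> x \<otimes> \<phi> r = \<phi> (a \<otimes>\<^bsub>R\<^esub> r) \<oplus> y \<otimes> \<phi> r"
  by (subst x_eq) (simp add: l_distr)

lemma q_phi': "\<lbrakk>r \<in> carrier R; u \<in> carrier S\<rbrakk> \<Longrightarrow> q \<otimes> (\<phi> r \<otimes> u) = \<phi> (b \<otimes>\<^bsub>R\<^esub> r) \<otimes> u"
  using q_phi[of r] by (simp flip: m_assoc)

lemma x_phi': "\<lbrakk>r \<in> carrier R; u \<in> carrier S\<rbrakk>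
    \<Longrightarrow> x \<otimes> (\<phi> r \<otimes> u) = \<phi> (a \<otimes>\<^bsub>R\<^esub> r) \<otimes> u \<oplus> y \<otimes> (\<phi> r \<otimes> u)"
  using x_phi[of r] by (simp add: l_distr flip: m_assoc)

lemma q_y': "u \<in> carrier S \<Longrightarrow> q \<otimes> (y \<otimes> u) = \<phi> d \<otimes> u"
  using q_y by (simp flip: m_assoc)

lemma x_y': "u \<in> carrier S \<Longrightarrow> x \<otimes> (y \<otimes> u) = \<zero>"
  using x_y by (simp flip: m_assoc)

text \<open>For e = q x and f = 1 - e, the summands after the first lie in e S e, e S f, f S e and f
  S f in turn; c f also lies in f S f. The coefficients are those of the matrix entries r, r' d, s
  and c 1 + s' d.\<close>

definition peirce :: "'f \<Rightarrow> 'r \<Rightarrow> 'r \<Rightarrow> 'r \<Rightarrow> 'r \<Rightarrow> 's" where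
  "peirce c r r' s s' = c \<odot> f \<oplus> \<phi> r \<oplus> \<phi> r' \<otimes> z \<oplus> y \<otimes> \<phi> s \<oplus> y \<otimes> (\<phi> s' \<otimes> z)"

lemma peirce_closed [simp]:
  "\<lbrakk>c \<in> carrier F; r \<in> carrier R; r' \<in> carrier R; s \<in> carrier R; s' \<in> carrier R\<rbrakk>
    \<Longrightarrow> peirce c r r' s s' \<in> carrier S"
  by (simp add: peirce_def)

lemma peirce_one: "\<one> = peirce \<one>\<^bsub>F\<^esub> \<one>\<^bsub>R\<^esub> \<zero>\<^bsub>R\<^esub> \<zero>\<^bsub>R\<^esub> \<zero>\<^bsub>R\<^esub>"
  by (simp add: peirce_def f_def a_minus_def a_assoc l_neg)

lemma peirce_zero: "peirce \<zero>\<^bsub>F\<^esub> \<zero>\<^bsub>R\<^esub> \<zero>\<^bsub>R\<^esub> \<zero>\<^bsub>R\<^esub> \<zero>\<^bsub>R\<^esub> = \<zero>"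
  by (simp add: peirce_def)

lemma peirce_add:
  assumes "c \<in> carrier F" "r \<in> carrier R" "r' \<in> carrier R" "s \<in> carrier R" "s' \<in> carrier R"
    "c2 \<in> carrier F" "r2 \<in> carrier R" "r2' \<in> carrier R" "s2 \<in> carrier R" "s2' \<in> carrier R"
  shows "peirce c r r' s s' \<oplus> peirce c2 r2 r2' s2 s2' = peirce (c \<oplus>\<^bsub>F\<^esub> c2) (r \<oplus>\<^bsub>R\<^esub> r2)
    (r' \<oplus>\<^bsub>R\<^esub> r2') (s \<oplus>\<^bsub>R\<^esub> s2) (s' \<oplus>\<^bsub>R\<^esub> s2')"
  using assms by (simp add: peirce_def l_distr r_distr scalars.smult_l_distr a_ac)

lemma peirce_smult:
  assumes "k \<in> carrier F"
    "c \<in> carrier F" "r \<in> carrier R" "r' \<in> carrier R" "s \<in> carrier R" "s' \<in> carrier R"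
  shows "k \<odot> peirce c r r' s s' = peirce (k \<otimes>\<^bsub>F\<^esub> c) (k \<odot>\<^bsub>R\<^esub> r) (k \<odot>\<^bsub>R\<^esub> r') (k \<odot>\<^bsub>R\<^esub> s) (k \<odot>\<^bsub>R\<^esub> s')"
  using assms by (simp add: peirce_def scalars.smult_r_distr scalars.smult_assoc1
    smult_mult_left smult_mult_right)

text \<open>Here q f = z turns c f into c z, which is \<open>\<phi>\<close> of a scalar times
  \<open>z\<close> because e z = z. The terms starting with \<open>y\<close> return to
  \<open>\<phi>\<close> through q y = \<open>\<phi> d\<close>.\<close>

lemma peirce_q:
  assumes "c \<in> carrier F" "r \<in> carrier R" "r' \<in> carrier R" "s \<in> carrier R" "s' \<in> carrier R"
  shows "q \<otimes> peirce c r r' s s' = peirce \<zero>\<^bsub>F\<^esub> (b \<otimes>\<^bsub>R\<^esub> r \<oplus>\<^bsub>R\<^esub> d \<otimes>\<^bsub>R\<^esub> s)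
    (c \<odot>\<^bsub>R\<^esub> \<one>\<^bsub>R\<^esub> \<oplus>\<^bsub>R\<^esub> (b \<otimes>\<^bsub>R\<^esub> r' \<oplus>\<^bsub>R\<^esub> d \<otimes>\<^bsub>R\<^esub> s')) \<zero>\<^bsub>R\<^esub> \<zero>\<^bsub>R\<^esub>"
  using assms by (simp add: peirce_def r_distr l_distr smult_mult_left smult_mult_right q_f q_phi
    q_phi' q_y' e_z m_assoc[of "\<phi> _" "\<phi> _" z] a_ac)

text \<open>Left multiplication by \<open>x\<close> kills \<open>f\<close> and all terms starting
  with \<open>y\<close>; on the other terms x = \<open>\<phi> a\<close> + y produces an
  \<open>a\<close>-multiple and a copy behind \<open>y\<close>.\<close>

lemma peirce_x:
  assumes "c \<in> carrier F" "r \<in> carrier R" "r' \<in> carrier R" "s \<in> carrier R" "s' \<in> carrier R"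
  shows "x \<otimes> peirce c r r' s s' = peirce \<zero>\<^bsub>F\<^esub> (a \<otimes>\<^bsub>R\<^esub> r) (a \<otimes>\<^bsub>R\<^esub> r') r r'"
  using assms by (simp add: peirce_def r_distr smult_mult_right x_f x_phi x_phi' x_y' a_ac)

lemma peirce_surj:
  assumes "u \<in> carrier S"
  obtains c r r' s s' where "c \<in> carrier F" "r \<in> carrier R" "r' \<in> carrier R"
    "s \<in> carrier R" "s' \<in> carrier R" "u = peirce c r r' s s'"
proof -
  let ?P = "\<lambda>u. \<exists>c\<in>carrier F. \<exists>r\<in>carrier R. \<exists>r'\<in>carrier R. \<exists>s\<in>carrier R. \<exists>s'\<in>carrier R.
    u = peirce c r r' s s'"
  have I: "?P (peirce c r r' s s')"
    if "c \<in> carrier F" "r \<in> carrier R" "r' \<in> carrier R" "s \<in> carrier R" "s' \<in> carrier R"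
    for c r r' s s' using that by blast
  have "?P u"
    using generates_S assms
  proof (induction rule: generates_induct)
    case one
    show ?case unfolding peirce_one by (rule I) simp_all
  next
    case (add u v)
    then obtain c r r' s s' c2 r2 r2' s2 s2' where
      "c \<in> carrier F" "r \<in> carrier R" "r' \<in> carrier R" "s \<in> carrier R" "s' \<in> carrier R"
      "c2 \<in> carrier F" "r2 \<in> carrier R" "r2' \<in> carrier R" "s2 \<in> carrier R" "s2' \<in> carrier R"
      "u = peirce c r r' s s'" "v = peirce c2 r2 r2' s2 s2'" by (elim bexE)
    then show ?case by (simp only: peirce_add) (rule I; simp)
  next
    case (smult k u)
    then obtain c r r' s s' where
      "c \<in> carrier F" "r \<in> carrier R" "r' \<in> carrier R" "s \<in> carrier R" "s' \<in> carrier R"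
      "u = peirce c r r' s s'" by (elim bexE)
    then show ?case using smult(1) by (simp only: peirce_smult) (rule I; simp)
  next
    case (mult g u)
    then obtain c r r' s s' where
      *: "c \<in> carrier F" "r \<in> carrier R" "r' \<in> carrier R" "s \<in> carrier R" "s' \<in> carrier R"
      "u = peirce c r r' s s'" by (elim bexE)
    from mult(1) have "g = q \<or> g = x" by blast
    then show ?case
    proof
      assume "g = q"
      with * show ?thesis by (simp only: peirce_q) (rule I; simp)
    next
      assume "g = x"
      with * show ?thesis by (simp only: peirce_x) (rule I; simp)
    qed
  qed (simp_all add: assoc_algebra_axioms)
  then show thesis by (elim bexE) (rule that)
qed

text \<open>Uniqueness of the Peirce coefficients is never shown inside \<open>S\<close>: they are
  read off from the image matrix, where \<open>cancel\<close> and \<open>scalar\<close> recover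
  them.\<close>

lemma iso_T_algebra:
  assumes h: "h \<in> algebra_hom F S (T_algebra F R a b)"
    and hq: "h q = Q_mat R a b" and hx: "h x = X_mat R a"
    and cancel: "\<And>r. \<lbrakk>r \<in> carrier R; r \<otimes>\<^bsub>R\<^esub> (\<one>\<^bsub>R\<^esub> \<ominus>\<^bsub>R\<^esub> b \<otimes>\<^bsub>R\<^esub> a) = \<zero>\<^bsub>R\<^esub>\<rbrakk> \<Longrightarrow> r = \<zero>\<^bsub>R\<^esub>"
    and scalar: "\<And>c r. \<lbrakk>c \<in> carrier F; r \<in> carrier R;
        c \<odot>\<^bsub>R\<^esub> \<one>\<^bsub>R\<^esub> \<oplus>\<^bsub>R\<^esub> r \<otimes>\<^bsub>R\<^esub> (\<one>\<^bsub>R\<^esub> \<ominus>\<^bsub>R\<^esub> b \<otimes>\<^bsub>R\<^esub> a) = \<zero>\<^bsub>R\<^esub>\<rbrakk> \<Longrightarrow> c = \<zero>\<^bsub>F\<^esub>"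
  shows "h \<in> algebra_iso F S (T_algebra F R a b)"
proof -
  let ?T = "T_algebra F R a b"
  let ?E = "\<lambda>r. Mat2 r \<zero>\<^bsub>R\<^esub> \<zero>\<^bsub>R\<^esub> \<zero>\<^bsub>R\<^esub>"
  note Tsimps = R.T_algebra_simps[OF ab_closed]
  interpret T: assoc_algebra F ?T by (rule R.T_algebra_assoc_algebra) simp_all
  note hom = algebra_homD[OF h]
  have zI: "\<zero>\<^bsub>R\<^esub> \<in> I_ideal R a b" "\<zero>\<^bsub>R\<^esub> \<in> scalars_plus_I F R a b"
    by (simp_all add: R.I_ideal_closed R.I_ideal_subset)
  have dI: "r \<otimes>\<^bsub>R\<^esub> d \<in> I_ideal R a b" if "r \<in> carrier R" for r
    using that by (auto simp: I_ideal_def d_def)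
  have dI1: "d \<in> I_ideal R a b" using dI[of "\<one>\<^bsub>R\<^esub>"] by simp
  have Q: "Q_mat R a b = Mat2 b d \<zero>\<^bsub>R\<^esub> \<zero>\<^bsub>R\<^esub>" by (simp add: Q_mat_def d_def)
  have X: "X_mat R a = Mat2 a \<zero>\<^bsub>R\<^esub> \<one>\<^bsub>R\<^esub> \<zero>\<^bsub>R\<^esub>" by (simp add: X_mat_def)
  have bad: "b \<otimes>\<^bsub>R\<^esub> a \<oplus>\<^bsub>R\<^esub> d = \<one>\<^bsub>R\<^esub>"
    by (simp add: d_def a_minus_def R.a_lcomm R.r_neg)
  have he: "h (q \<otimes> x) = ?E \<one>\<^bsub>R\<^esub>"
    by (simp add: hom hq hx Q X Tsimps bad)
  \<comment> \<open>Following \<open>\<phi>\<close> by \<open>h\<close> should embed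
    \<open>R\<close> as the upper left corner. By generation it suffices to check the unit and the
    generators, with \<open>\<phi> a\<close> = e x and \<open>\<phi> b\<close> = q e for e = q
    x.\<close>
  have hphi: "h (\<phi> r) = ?E r" if "r \<in> carrier R" for r
    using generates_R that
  proof (induction rule: generates_induct)
    case (mult g r)
    have "h (\<phi> a) = h (q \<otimes> x) \<otimes>\<^bsub>?T\<^esub> h x"
      using hom(3)[of "q \<otimes> x" x] by (simp add: phi_a m_assoc)
    then have "h (\<phi> a) = ?E a"
      by (simp add: he hx X Tsimps)
    moreover have "h (\<phi> b) = h q \<otimes>\<^bsub>?T\<^esub> h (q \<otimes> x)"
      using hom(3)[of q "q \<otimes> x"] by (simp add: phi_b)
    then have "h (\<phi> b) = ?E b"
      by (simp add: he hq Q Tsimps)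
    ultimately show ?case using mult by (auto simp: hom Tsimps)
  qed (auto simp: he hom Tsimps intro: R.assoc_algebra_axioms)
  have hmin: "h (u \<ominus> v) = h u \<ominus>\<^bsub>?T\<^esub> h v" if "u \<in> carrier S" "v \<in> carrier S" for u v
    using algebra_hom_diff[OF assoc_algebra_axioms T.assoc_algebra_axioms h that] .
  note minus = R.T_algebra_minus[OF ab_closed]
  have hf: "h f = Mat2 \<zero>\<^bsub>R\<^esub> \<zero>\<^bsub>R\<^esub> \<zero>\<^bsub>R\<^esub> \<one>\<^bsub>R\<^esub>"
    by (simp add: f_def hmin he hom Tsimps minus R.minus_eq_zero_iff R.diff_zero_right zI R.scalars_plus_I_closed)
  have hy: "h y = Mat2 \<zero>\<^bsub>R\<^esub> \<zero>\<^bsub>R\<^esub> \<one>\<^bsub>R\<^esub> \<zero>\<^bsub>R\<^esub>"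
    using hphi[of a] by (simp add: y_def hmin hx X Tsimps minus R.minus_eq_zero_iff R.diff_zero_right zI flip: phi_a)
  have hz: "h z = Mat2 \<zero>\<^bsub>R\<^esub> d \<zero>\<^bsub>R\<^esub> \<zero>\<^bsub>R\<^esub>"
    using hphi[of b] by (simp add: z_def hmin hq Q Tsimps minus R.minus_eq_zero_iff R.diff_zero_right zI dI1 flip: phi_b)
  have hpeirce: "h (peirce c r r' s s')
      = Mat2 r (r' \<otimes>\<^bsub>R\<^esub> d) s (c \<odot>\<^bsub>R\<^esub> \<one>\<^bsub>R\<^esub> \<oplus>\<^bsub>R\<^esub> s' \<otimes>\<^bsub>R\<^esub> d)"
    if "c \<in> carrier F" "r \<in> carrier R" "r' \<in> carrier R" "s \<in> carrier R" "s' \<in> carrier R"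
    for c r r' s s'
    using that by (simp add: peirce_def hom hf hphi hy hz Tsimps)
  have inj0: "u = \<zero>" if u: "u \<in> carrier S" "h u = \<zero>\<^bsub>?T\<^esub>" for u
  proof -
    obtain c r r' s s' where *: "c \<in> carrier F" "r \<in> carrier R" "r' \<in> carrier R"
      "s \<in> carrier R" "s' \<in> carrier R" and eq: "u = peirce c r r' s s'"
      using u(1) by (rule peirce_surj)
    have z: "r = \<zero>\<^bsub>R\<^esub>" "r' \<otimes>\<^bsub>R\<^esub> d = \<zero>\<^bsub>R\<^esub>" "s = \<zero>\<^bsub>R\<^esub>"
      "c \<odot>\<^bsub>R\<^esub> \<one>\<^bsub>R\<^esub> \<oplus>\<^bsub>R\<^esub> s' \<otimes>\<^bsub>R\<^esub> d = \<zero>\<^bsub>R\<^esub>"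
      using u(2) * by (simp_all add: eq hpeirce Tsimps)
    \<comment> \<open>The scalar has to go first; only then is the lower right entry a plain
      multiple of \<open>d\<close>, to which \<open>cancel\<close> applies.\<close>
    have c: "c = \<zero>\<^bsub>F\<^esub>" by (rule scalar[of c s']) (use z(4) * in \<open>simp_all add: d_def\<close>)
    have "r' = \<zero>\<^bsub>R\<^esub>" by (rule cancel) (use z(2) * in \<open>simp_all add: d_def\<close>)
    moreover have "s' = \<zero>\<^bsub>R\<^esub>" by (rule cancel) (use z(4) * c in \<open>simp_all add: d_def\<close>)
    ultimately show ?thesis using z c eq peirce_zero by simp
  qed
  have "inj_on h (carrier S)"
  proof (rule inj_onI)
    fix u v assume uv: "u \<in> carrier S" "v \<in> carrier S" "h u = h v"
    then have "h (u \<ominus> v) = \<zero>\<^bsub>?T\<^esub>" using T.minus_eq_zero_iff[of "h u" "h v"] by (simp only: hmin hom)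
    then have "u \<ominus> v = \<zero>" using uv inj0 by simp
    then show "u = v" using uv by (simp add: minus_eq_zero_iff)
  qed
  moreover have "carrier ?T \<subseteq> h ` carrier S"
  proof
    fix M assume "M \<in> carrier ?T"
    then obtain r i s t where M: "M = Mat2 r i s t" "r \<in> carrier R" "i \<in> I_ideal R a b"
      "s \<in> carrier R" "t \<in> scalars_plus_I F R a b" by (rule R.T_algebra_carrierE[OF ab_closed])
    then obtain r' c s' where "r' \<in> carrier R" "i = r' \<otimes>\<^bsub>R\<^esub> d" "c \<in> carrier F" "s' \<in> carrier R"
      "t = c \<odot>\<^bsub>R\<^esub> \<one>\<^bsub>R\<^esub> \<oplus>\<^bsub>R\<^esub> s' \<otimes>\<^bsub>R\<^esub> d"
      by (auto simp: I_ideal_def scalars_plus_I_def d_def)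
    with M have "M = h (peirce c r r' s s')" "peirce c r r' s s' \<in> carrier S"
      by (simp_all add: hpeirce)
    then show "M \<in> h ` carrier S" by blast
  qed
  ultimately have "bij_betw h (carrier S) (carrier ?T)"
    using hom(1) by (auto simp: bij_betw_def)
  with h show ?thesis
    by (simp add: algebra_iso_def algebra_hom_def ring_iso_def)
qed

end

section \<open>Scalars and cancellation\<close>

text \<open>\<open>F\<close> as an algebra over itself, so that matrices over \<open>F\<close>
  become an instance of \<open>mat2_algebra\<close>.\<close>

definition scalar_algebra :: "('f, 'm) ring_scheme \<Rightarrow> ('f, 'f) module" where
  "scalar_algebra F = \<lparr>carrier = carrier F, mult = mult F, one = \<one>\<^bsub>F\<^esub>, zero = \<zero>\<^bsub>F\<^esub>,
    add = add F, smult = mult F\<rparr>"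

lemma scalar_algebra_simps [simp]:
  "carrier (scalar_algebra F) = carrier F" "mult (scalar_algebra F) = mult F"
  "\<one>\<^bsub>scalar_algebra F\<^esub> = \<one>\<^bsub>F\<^esub>" "\<zero>\<^bsub>scalar_algebra F\<^esub> = \<zero>\<^bsub>F\<^esub>"
  "add (scalar_algebra F) = add F" "smult (scalar_algebra F) = mult F"
  by (simp_all add: scalar_algebra_def)

lemma (in cring) scalar_algebra_assoc_algebra: "assoc_algebra R (scalar_algebra R)"
  by (rule assoc_algebraI[OF is_cring]) (simp_all add: m_ac a_ac l_distr r_distr)

text \<open>The image of ba under \<open>\<rho>\<close> is E12 E21 = E11, an idempotent, so
  \<open>\<rho>\<close> kills (1 - ba) ba. Multiplying the equation by ba on the right and applying
  \<open>\<rho>\<close> leaves c E11 = 0.\<close>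

lemma scalar_not_in_I:
  fixes A (structure)
  assumes A: "assoc_algebra F A" and ab: "a \<in> carrier A" "b \<in> carrier A"
    and \<rho>: "\<rho> \<in> algebra_hom F A (mat2_algebra (scalar_algebra F))"
    and \<rho>a: "\<rho> a = Mat2 \<zero>\<^bsub>F\<^esub> \<zero>\<^bsub>F\<^esub> \<one>\<^bsub>F\<^esub> \<zero>\<^bsub>F\<^esub>" and \<rho>b: "\<rho> b = Mat2 \<zero>\<^bsub>F\<^esub> \<one>\<^bsub>F\<^esub> \<zero>\<^bsub>F\<^esub> \<zero>\<^bsub>F\<^esub>"
    and c: "c \<in> carrier F" and r: "r \<in> carrier A" and eq: "c \<odot> \<one> \<oplus> r \<otimes> (\<one> \<ominus> b \<otimes> a) = \<zero>"
  shows "c = \<zero>\<^bsub>F\<^esub>"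
proof -
  interpret A: assoc_algebra F A by fact
  interpret F: assoc_algebra F "scalar_algebra F"
    by (rule A.scalars.R.scalar_algebra_assoc_algebra)
  let ?M = "mat2_algebra (scalar_algebra F)"
  note M = F.mat2_assoc_algebra
  interpret M: assoc_algebra F ?M by (rule M)
  note hom = algebra_homD[OF \<rho>]
  let ?d = "\<one> \<ominus> b \<otimes> a"
  let ?E = "Mat2 \<one>\<^bsub>F\<^esub> \<zero>\<^bsub>F\<^esub> \<zero>\<^bsub>F\<^esub> \<zero>\<^bsub>F\<^esub>"
  have d: "?d \<in> carrier A" using ab by simp
  have "?d \<otimes> (b \<otimes> a) = b \<otimes> a \<ominus> b \<otimes> a \<otimes> (b \<otimes> a)"
    using ab by (simp add: a_minus_def A.l_distr A.l_minus)
  moreover have \<rho>ba: "\<rho> (b \<otimes> a) = ?E"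
    using ab by (simp add: hom \<rho>a \<rho>b)
  then have "\<rho> (b \<otimes> a \<otimes> (b \<otimes> a)) = \<rho> (b \<otimes> a)"
    using ab hom(3)[of "b \<otimes> a" "b \<otimes> a"] by simp
  ultimately have "\<rho> (?d \<otimes> (b \<otimes> a)) = \<zero>\<^bsub>?M\<^esub>"
    using ab algebra_hom_diff[OF A M \<rho>, of "b \<otimes> a" "b \<otimes> a \<otimes> (b \<otimes> a)"] hom(1)[of "b \<otimes> a"]
    by (simp del: F.mat2_simps add: M.minus_eq_zero_iff)
  moreover have "(c \<odot> \<one> \<oplus> r \<otimes> ?d) \<otimes> (b \<otimes> a) = c \<odot> (b \<otimes> a) \<oplus> r \<otimes> (?d \<otimes> (b \<otimes> a))"
    using ab c r d by (simp add: A.l_distr A.m_assoc A.scalar_mult)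
  then have "\<rho> \<zero> = \<rho> (c \<odot> (b \<otimes> a) \<oplus> r \<otimes> (?d \<otimes> (b \<otimes> a)))"
    using ab by (simp add: eq)
  then have "\<zero>\<^bsub>?M\<^esub> = c \<odot>\<^bsub>?M\<^esub> \<rho> (b \<otimes> a) \<oplus>\<^bsub>?M\<^esub> \<rho> r \<otimes>\<^bsub>?M\<^esub> \<rho> (?d \<otimes> (b \<otimes> a))"
    using algebra_hom_zero[OF A M \<rho>] hom(2)[of "c \<odot> (b \<otimes> a)" "r \<otimes> (?d \<otimes> (b \<otimes> a))"]
      hom(5)[of c "b \<otimes> a"] hom(3)[of r "?d \<otimes> (b \<otimes> a)"] ab c r d by simp
  ultimately have "\<zero>\<^bsub>?M\<^esub> = c \<odot>\<^bsub>?M\<^esub> ?E \<oplus>\<^bsub>?M\<^esub> \<zero>\<^bsub>?M\<^esub>"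
    using hom(1)[OF r] M.r_null[of "\<rho> r"] \<rho>ba by metis
  then show ?thesis using c by simp
qed

section \<open>Monomial ideals and right cancellation of 1 - ba\<close>

text \<open>In lowest degree the elements \<open>r\<close> and \<open>r (1 - v)\<close> agree.\<close>

lemma (in cring) supported_mult_cancel:
  fixes bad :: "'x list \<Rightarrow> bool"
  assumes r: "r \<in> carrier (free_algebra R)" and v: "v \<noteq> []"
    and bad: "\<And>u. bad u \<Longrightarrow> bad (u @ v)"
    and supp: "\<And>w. (r \<ominus>\<^bsub>free_algebra R\<^esub> r \<otimes>\<^bsub>free_algebra R\<^esub> monomial R \<one> v) w \<noteq> \<zero> \<Longrightarrow> bad w"
    and w: "r w \<noteq> \<zero>"
  shows "bad w"
  using w
proof (induction w rule: length_induct)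
  case (1 w)
  interpret A: assoc_algebra R "free_algebra R" by (rule free_algebra_assoc_algebra)
  let ?p = "r \<otimes>\<^bsub>free_algebra R\<^esub> monomial R \<one> v"
  have p: "?p \<in> carrier (free_algebra R)" using r by simp
  have coeff: "\<And>w. r w \<in> carrier R" "\<And>w. ?p w \<in> carrier R" "\<And>w. monomial R \<one> v w \<in> carrier R"
    by (rule free_algebra_coeff[OF r] free_algebra_coeff[OF p] free_algebra_coeff[OF monomial_closed],
      simp?)+
  have eq: "(r \<ominus>\<^bsub>free_algebra R\<^esub> ?p) w = r w \<ominus> ?p w"
    unfolding a_minus_def A.minus_eq_smult[OF p]
    by (simp add: free_algebra_simps coeff l_minus)
  show ?case
  \<comment> \<open>If r v has no term at \<open>w\<close>, the coefficient of r - r v there is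
    \<open>r w\<close>, and \<open>supp\<close> applies. Otherwise w = u v with \<open>u\<close> in
    the support of \<open>r\<close>; \<open>u\<close> is strictly shorter because \<open>v\<close>
    is nonempty, so it is bad by induction, and appending \<open>v\<close> keeps it bad.\<close>
  proof (cases "?p w = \<zero>")
    case True
    then show ?thesis using supp[of w] eq 1(2) coeff by (simp add: diff_zero_right)
  next
    case False
    then have "conv R r (monomial R \<one> v) w \<noteq> \<zero>" by (simp add: free_algebra_mult)
    then obtain u u' where u: "w = u @ u'" "r u \<noteq> \<zero>" "monomial R \<one> v u' \<noteq> \<zero>"
      using coeff by (auto elim: conv_nonzeroE)
    then have "u' = v" by (auto simp: monomial_def split: if_splits)
    then show ?thesis using 1(1) u v bad by auto
  qed
qed

text \<open>The elements whose words all contain the factor \<open>v\<close> form a two-sided ideal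
  with \<open>v\<close> in it, so minimality gives one direction. Conversely each term of such an
  element has the form c u v u', a multiple of \<open>v\<close>.\<close>

lemma (in cring) genideal_monomial:
  fixes p :: "'x list \<Rightarrow> 'a"
  assumes "p \<in> carrier (free_algebra R)"
  shows "p \<in> Idl\<^bsub>free_algebra R\<^esub> {monomial R \<one> v}
    \<longleftrightarrow> (\<forall>w. p w \<noteq> \<zero> \<longrightarrow> (\<exists>u u'. w = u @ v @ u'))"
    (is "_ \<in> ?I \<longleftrightarrow> ?Q p")
proof
  interpret A: assoc_algebra R "free_algebra R" by (rule free_algebra_assoc_algebra)
  have I: "ideal ?I (free_algebra R)" by (rule A.genideal_ideal) simp
  interpret I: ideal ?I "free_algebra R" by (rule I)
  let ?K = "{p \<in> carrier (free_algebra R). ?Q p}"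
  have sub: "subgroup ?K (add_monoid (free_algebra R))"
  proof (rule A.add.subgroupI)
    show "?K \<noteq> {}" using A.zero_closed by (auto simp: free_algebra_simps)
  next
    fix p assume p: "p \<in> ?K"
    then have "p w \<in> carrier R" for w by (simp add: free_algebra_carrier_iff)
    then have "?Q ((\<ominus> \<one>) \<odot>\<^bsub>free_algebra R\<^esub> p)"
      using p by (auto simp: free_algebra_simps l_minus)
    then show "\<ominus>\<^bsub>free_algebra R\<^esub> p \<in> ?K"
      using p A.a_inv_closed[of p] by (simp add: A.minus_eq_smult)
  next
    fix p p' assume p: "p \<in> ?K" "p' \<in> ?K"
    have "?Q (p \<oplus>\<^bsub>free_algebra R\<^esub> p')"
    proof (intro allI impI)
      fix w assume "(p \<oplus>\<^bsub>free_algebra R\<^esub> p') w \<noteq> \<zero>"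
      then have "p w \<noteq> \<zero> \<or> p' w \<noteq> \<zero>" by (auto simp: free_algebra_simps)
      then show "\<exists>u u'. w = u @ v @ u'" using p by blast
    qed
    then show "p \<oplus>\<^bsub>free_algebra R\<^esub> p' \<in> ?K" using p by simp
  qed auto
  have "ideal ?K (free_algebra R)"
  proof (rule idealI[OF A.ring_axioms sub])
    fix p t :: "'x list \<Rightarrow> 'a" assume p: "p \<in> ?K" and t: "t \<in> carrier (free_algebra R)"
    have c: "\<And>w. p w \<in> carrier R" "\<And>w. t w \<in> carrier R"
      using p t by (auto simp: free_algebra_carrier_iff)
    have "\<exists>u u'. w = u @ v @ u'" if tp: "conv R t p w \<noteq> \<zero>" for w
    proof -
      obtain w1 w2 where w: "w = w1 @ w2" "p w2 \<noteq> \<zero>"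
        using conv_nonzeroE[OF tp c(2) c(1)] by blast
      then obtain u u' where "w2 = u @ v @ u'" using p by blast
      with w have "w = (w1 @ u) @ v @ u'" by simp
      then show ?thesis by blast
    qed
    then show "t \<otimes>\<^bsub>free_algebra R\<^esub> p \<in> ?K"
      using A.m_closed[of t p] p t by (simp add: free_algebra_mult)
    have "\<exists>u u'. w = u @ v @ u'" if pt: "conv R p t w \<noteq> \<zero>" for w
    proof -
      obtain w1 w2 where w: "w = w1 @ w2" "p w1 \<noteq> \<zero>"
        using conv_nonzeroE[OF pt c(1) c(2)] by blast
      then obtain u u' where "w1 = u @ v @ u'" using p by blast
      with w have "w = u @ v @ (u' @ w2)" by simp
      then show ?thesis by blast
    qed
    then show "p \<otimes>\<^bsub>free_algebra R\<^esub> t \<in> ?K"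
      using A.m_closed[of p t] p t by (simp add: free_algebra_mult)
  qed
  moreover have "monomial R \<one> v \<in> ?K"
  proof -
    have "v = [] @ v @ []" by simp
    then have "?Q (monomial R \<one> v)" unfolding monomial_def by metis
    then show ?thesis by simp
  qed
  ultimately have "?I \<subseteq> ?K" by (intro A.genideal_minimal) auto
  then show "?Q p" if "p \<in> ?I" using that by blast
  have mem: "monomial R \<one> v \<in> ?I" by (rule A.genideal_self') simp
  show "p \<in> ?I" if Q: "?Q p"
    using assms
  proof (induction rule: free_algebra_induct)
    case zero
    show ?case by (rule I.zero_closed)
  next
    \<comment> \<open>This is a term of \<open>p\<close> itself, so \<open>Q\<close> supplies the
      factorization of its word.\<close>
    case (monomial w)
    then obtain u u' where w: "w = u @ v @ u'" using Q by blast
    have "p w \<in> carrier R" using assms by (rule free_algebra_coeff)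
    then have "monomial R (p w) w = monomial R (p w) u \<otimes>\<^bsub>free_algebra R\<^esub>
        (monomial R \<one> v \<otimes>\<^bsub>free_algebra R\<^esub> monomial R \<one> u')"
      by (simp add: monomial_mult w)
    also have "\<dots> \<in> ?I"
      using mem \<open>p w \<in> carrier R\<close> by (intro I.I_l_closed I.I_r_closed) simp_all
    finally show ?case .
  next
    case (add p p')
    then show ?case by (intro I.a_closed)
  qed
qed

lemma (in cring) mult_one_minus_monomial:
  assumes "r \<in> carrier (free_algebra R)"
  shows "r \<otimes>\<^bsub>free_algebra R\<^esub>
      (\<one>\<^bsub>free_algebra R\<^esub> \<ominus>\<^bsub>free_algebra R\<^esub> free_gen R y \<otimes>\<^bsub>free_algebra R\<^esub> free_gen R x)
    = r \<ominus>\<^bsub>free_algebra R\<^esub> r \<otimes>\<^bsub>free_algebra R\<^esub> monomial R \<one> [y, x]"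
proof -
  interpret A: assoc_algebra R "free_algebra R" by (rule free_algebra_assoc_algebra)
  have "free_gen R y \<otimes>\<^bsub>free_algebra R\<^esub> free_gen R x = monomial R \<one> [y, x]"
    by (simp add: free_gen_eq_monomial monomial_mult)
  then show ?thesis using assms by (simp add: a_minus_def A.r_distr A.r_minus)
qed

text \<open>\<open>supported_mult_cancel\<close> with no bad words: the product has empty support,
  and therefore so has \<open>r\<close>.\<close>

lemma (in cring) free_algebra_cancel:
  assumes r: "r \<in> carrier (free_algebra R)"
    and "r \<otimes>\<^bsub>free_algebra R\<^esub>
      (\<one>\<^bsub>free_algebra R\<^esub> \<ominus>\<^bsub>free_algebra R\<^esub> free_gen R y \<otimes>\<^bsub>free_algebra R\<^esub> free_gen R x)
      = \<zero>\<^bsub>free_algebra R\<^esub>"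
  shows "r = \<zero>\<^bsub>free_algebra R\<^esub>"
proof -
  have "(r \<ominus>\<^bsub>free_algebra R\<^esub> r \<otimes>\<^bsub>free_algebra R\<^esub> monomial R \<one> [y, x]) w = \<zero>" for w
    using assms by (simp add: mult_one_minus_monomial) (simp add: free_algebra_simps)
  then have "r w = \<zero>" for w
    using supported_mult_cancel[OF r, of "[y, x]" "\<lambda>_. False" w] by auto
  then show ?thesis by (simp add: free_algebra_simps fun_eq_iff)
qed

text \<open>Lift \<open>r\<close> to \<open>p\<close> in the free algebra. The hypothesis says that
  every word of p (1 - yx) contains the factor x^m. Calling such words bad, a property kept when yx
  is appended, every word of \<open>p\<close> is bad too, so \<open>p\<close> lies in the
  ideal.\<close>

lemma (in cring) nil_algebra_cancel:
  fixes x y :: 'x and m :: nat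
  defines "rels \<equiv> {free_gen R x [^]\<^bsub>free_algebra R\<^esub> m}"
  defines "A \<equiv> presented_algebra R rels"
  assumes r: "r \<in> carrier A"
    and eq: "r \<otimes>\<^bsub>A\<^esub> (\<one>\<^bsub>A\<^esub> \<ominus>\<^bsub>A\<^esub> presented_gen R rels y \<otimes>\<^bsub>A\<^esub> presented_gen R rels x) = \<zero>\<^bsub>A\<^esub>"
  shows "r = \<zero>\<^bsub>A\<^esub>"
proof -
  interpret free: assoc_algebra R "free_algebra R" by (rule free_algebra_assoc_algebra)
  have rels: "rels = {monomial R \<one> (replicate m x)}"
    by (simp add: rels_def free_gen_pow)
  then have sub: "rels \<subseteq> carrier (free_algebra R)" by simp
  define \<pi> where "\<pi> = (\<lambda>p. (Idl\<^bsub>free_algebra R\<^esub> rels) +>\<^bsub>free_algebra R\<^esub> p)"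
  note facts = presented_algebra_facts[OF sub, folded A_def \<pi>_def]
  interpret A: assoc_algebra R A by (rule facts(1))
  note hom = algebra_homD[OF facts(2)]
  obtain p where p: "p \<in> carrier (free_algebra R)" "r = \<pi> p"
    using r facts(3) by blast
  let ?p' = "p \<otimes>\<^bsub>free_algebra R\<^esub>
      (\<one>\<^bsub>free_algebra R\<^esub> \<ominus>\<^bsub>free_algebra R\<^esub> free_gen R y \<otimes>\<^bsub>free_algebra R\<^esub> free_gen R x)"
  have p': "?p' \<in> carrier (free_algebra R)" using p(1) by simp
  have "\<pi> (\<one>\<^bsub>free_algebra R\<^esub> \<ominus>\<^bsub>free_algebra R\<^esub> free_gen R y \<otimes>\<^bsub>free_algebra R\<^esub> free_gen R x)
      = \<one>\<^bsub>A\<^esub> \<ominus>\<^bsub>A\<^esub> presented_gen R rels y \<otimes>\<^bsub>A\<^esub> presented_gen R rels x"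
    using algebra_hom_diff[OF free.assoc_algebra_axioms facts(1,2)]
    by (simp add: hom(3,4) facts(5))
  then have "\<pi> ?p' = \<zero>\<^bsub>A\<^esub>"
    using p eq by (simp add: hom(3))
  then have "?p' \<in> Idl\<^bsub>free_algebra R\<^esub> rels"
    using facts(4)[OF p'] by simp
  then have "\<forall>w. ?p' w \<noteq> \<zero> \<longrightarrow> (\<exists>u u'. w = u @ replicate m x @ u')"
    unfolding rels genideal_monomial[OF p'] .
  then have supp: "\<exists>u u'. w = u @ replicate m x @ u'"
    if "(p \<ominus>\<^bsub>free_algebra R\<^esub> p \<otimes>\<^bsub>free_algebra R\<^esub> monomial R \<one> [y, x]) w \<noteq> \<zero>" for w
    using that unfolding mult_one_minus_monomial[OF p(1)] by blast
  have "\<exists>u u'. w = u @ replicate m x @ u'" if "p w \<noteq> \<zero>" for w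
    using p(1) _ _ supp that
  proof (rule supported_mult_cancel)
    show "\<exists>v v'. u @ [y, x] = v @ replicate m x @ v'"
      if "\<exists>v v'. u = v @ replicate m x @ v'" for u
      using that by (metis append.assoc)
  qed simp
  then have "p \<in> Idl\<^bsub>free_algebra R\<^esub> rels"
    using genideal_monomial[OF p(1)] by (simp add: rels)
  then show ?thesis
    using p facts(4) by simp
qed

section \<open>The two presentations\<close>

lemma (in cring) S_rels_closed: "S_rels R \<subseteq> carrier (free_algebra R)"
proof -
  interpret free: assoc_algebra R "free_algebra R" by (rule free_algebra_assoc_algebra)
  show ?thesis by (simp add: S_rels_def Let_def)
qed

lemma (in cring) S_rels_eval:
  assumes B: "assoc_algebra R B" and g: "\<And>i. g i \<in> carrier B"
    and rel: "g Gen_q \<otimes>\<^bsub>B\<^esub> g Gen_x \<otimes>\<^bsub>B\<^esub> g Gen_q = g Gen_q"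
      "g Gen_x \<otimes>\<^bsub>B\<^esub> g Gen_q \<otimes>\<^bsub>B\<^esub> g Gen_x = g Gen_x"
    and p: "p \<in> S_rels R"
  shows "free_eval R B g p = \<zero>\<^bsub>B\<^esub>"
proof -
  interpret free: assoc_algebra R "free_algebra R" by (rule free_algebra_assoc_algebra)
  interpret B: assoc_algebra R B by (rule B)
  note eval = B.free_eval_hom[of g, OF g]
  note hom = algebra_homD[OF eval(1)]
  show ?thesis
    using p algebra_hom_diff[OF free.assoc_algebra_axioms B eval(1)] g rel
    by (auto simp: S_rels_def Let_def hom eval(2) B.minus_eq_zero_iff)
qed

text \<open>Allowing a larger set of relations makes this serve both presentations of
  \<open>S\<close>.\<close>

lemma (in cring) S_rels_presented:
  assumes sub: "S_rels R \<subseteq> rels" "rels \<subseteq> carrier (free_algebra R)"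
  defines "S \<equiv> presented_algebra R rels" and "q \<equiv> presented_gen R rels Gen_q"
    and "x \<equiv> presented_gen R rels Gen_x"
  shows "q \<otimes>\<^bsub>S\<^esub> x \<otimes>\<^bsub>S\<^esub> q = q" "x \<otimes>\<^bsub>S\<^esub> q \<otimes>\<^bsub>S\<^esub> x = x"
proof -
  interpret free: assoc_algebra R "free_algebra R" by (rule free_algebra_assoc_algebra)
  define \<pi> where "\<pi> = (\<lambda>p. (Idl\<^bsub>free_algebra R\<^esub> rels) +>\<^bsub>free_algebra R\<^esub> p)"
  note facts = presented_algebra_facts[OF sub(2), folded S_def \<pi>_def]
  interpret S: assoc_algebra R S by (rule facts(1))
  note hom = algebra_homD[OF facts(2)]
  have zero: "\<pi> p = \<zero>\<^bsub>S\<^esub>" if "p \<in> S_rels R" for p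
    using that facts(4) free.genideal_self[OF sub(2)] sub by blast
  have qx: "q \<in> carrier S" "x \<in> carrier S" using facts(6) by (simp_all add: q_def x_def)
  have diff: "\<pi> (u \<ominus>\<^bsub>free_algebra R\<^esub> v) = \<pi> u \<ominus>\<^bsub>S\<^esub> \<pi> v"
    if "u \<in> carrier (free_algebra R)" "v \<in> carrier (free_algebra R)" for u v
    using algebra_hom_diff[OF free.assoc_algebra_axioms facts(1,2) that] .
  let ?q = "free_gen R Gen_q" and ?x = "free_gen R Gen_x" and ?A = "free_algebra R"
  have "\<pi> (?q \<ominus>\<^bsub>?A\<^esub> ?q \<otimes>\<^bsub>?A\<^esub> ?x \<otimes>\<^bsub>?A\<^esub> ?q) = \<zero>\<^bsub>S\<^esub>"
    "\<pi> (?x \<ominus>\<^bsub>?A\<^esub> ?x \<otimes>\<^bsub>?A\<^esub> ?q \<otimes>\<^bsub>?A\<^esub> ?x) = \<zero>\<^bsub>S\<^esub>"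
    by (rule zero, simp add: S_rels_def Let_def)+
  then show "q \<otimes>\<^bsub>S\<^esub> x \<otimes>\<^bsub>S\<^esub> q = q" "x \<otimes>\<^bsub>S\<^esub> q \<otimes>\<^bsub>S\<^esub> x = x"
    using qx by (simp_all add: diff hom(3) facts(5) S.minus_eq_zero_iff flip: q_def x_def)
qed

text \<open>QX = E11 because ba + (1 - ba) = 1. Then E11 Q = Q, as the second row of Q vanishes, and
  X E11 = X, as the second column of X does.\<close>

lemma (in assoc_algebra) QX_relations:
  assumes "a \<in> carrier A" "b \<in> carrier A"
  defines "Q \<equiv> Q_mat A a b" and "X \<equiv> X_mat A a"
  shows "Q \<otimes>\<^bsub>mat2_algebra A\<^esub> X \<otimes>\<^bsub>mat2_algebra A\<^esub> Q = Q" "X \<otimes>\<^bsub>mat2_algebra A\<^esub> Q \<otimes>\<^bsub>mat2_algebra A\<^esub> X = X"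
proof -
  have d: "b \<otimes> a \<oplus> (\<one> \<ominus> b \<otimes> a) = \<one>"
    using assms(1,2) by (simp add: a_minus_def a_lcomm r_neg)
  interpret M: assoc_algebra F "mat2_algebra A" by (rule mat2_assoc_algebra)
  have QX: "Q \<otimes>\<^bsub>mat2_algebra A\<^esub> X = Mat2 \<one> \<zero> \<zero> \<zero>"
    using assms(1,2) by (simp add: Q_def X_def Q_mat_def X_mat_def d)
  then show "Q \<otimes>\<^bsub>mat2_algebra A\<^esub> X \<otimes>\<^bsub>mat2_algebra A\<^esub> Q = Q"
    using assms(1,2) by (simp add: Q_def Q_mat_def)
  have c: "X \<in> carrier (mat2_algebra A)" "Q \<in> carrier (mat2_algebra A)"
    using assms(1,2) by (simp_all add: Q_def X_def Q_mat_def X_mat_def)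
  then show "X \<otimes>\<^bsub>mat2_algebra A\<^esub> Q \<otimes>\<^bsub>mat2_algebra A\<^esub> X = X"
    using assms(1,2) by (simp add: M.m_assoc QX) (simp add: X_def X_mat_def)
qed

text \<open>The lower left entry lags one power behind. This is why x^n = 0 on one side is paired
  with a^(n-1) = 0 on the other.\<close>

lemma (in assoc_algebra) X_mat_pow:
  assumes "a \<in> carrier A" "b \<in> carrier A"
  shows "X_mat A a [^]\<^bsub>T_algebra F A a b\<^esub> Suc k = Mat2 (a [^] Suc k) \<zero> (a [^] k) \<zero>"
  using assms by (induction k) (simp_all add: X_mat_def)

lemma UNIV_gen_ab: "UNIV = {Gen_a, Gen_b}"
  by (auto intro: gen_ab.exhaust)

lemma UNIV_gen_qx: "UNIV = {Gen_q, Gen_x}"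
  by (auto intro: gen_qx.exhaust)

text \<open>The shared reduction. What remains for each case is that extra relations of
  \<open>S\<close> vanish on the matrices, that \<open>\<phi>\<close> and \<open>\<rho>\<close>
  exist, and that 1 - ba cancels on the right.\<close>

lemma (in cring) presented_iso_T_algebra:
  fixes A :: "('a, 'r, 'l) module_scheme" and rels
  defines "S \<equiv> presented_algebra R rels" and "q \<equiv> presented_gen R rels Gen_q"
    and "x \<equiv> presented_gen R rels Gen_x"
  assumes rels: "S_rels R \<subseteq> rels" "rels \<subseteq> carrier (free_algebra R)"
    and A: "assoc_algebra R A" and ab: "a \<in> carrier A" "b \<in> carrier A"
    and gen: "generates R A {a, b}"
    and zero: "\<And>p. p \<in> rels - S_rels R \<Longrightarrow> free_eval R (T_algebra R A a b)
        (case_gen_qx (Q_mat A a b) (X_mat A a)) p = \<zero>\<^bsub>T_algebra R A a b\<^esub>"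
    and phi: "\<phi> \<in> algebra_hom R A (corner S (q \<otimes>\<^bsub>S\<^esub> x))"
      "\<phi> a = q \<otimes>\<^bsub>S\<^esub> (x \<otimes>\<^bsub>S\<^esub> x)" "\<phi> b = q \<otimes>\<^bsub>S\<^esub> (q \<otimes>\<^bsub>S\<^esub> x)"
    and \<rho>: "\<rho> \<in> algebra_hom R A (mat2_algebra (scalar_algebra R))"
      "\<rho> a = Mat2 \<zero> \<zero> \<one> \<zero>" "\<rho> b = Mat2 \<zero> \<one> \<zero> \<zero>"
    and cancel: "\<And>r. \<lbrakk>r \<in> carrier A; r \<otimes>\<^bsub>A\<^esub> (\<one>\<^bsub>A\<^esub> \<ominus>\<^bsub>A\<^esub> b \<otimes>\<^bsub>A\<^esub> a) = \<zero>\<^bsub>A\<^esub>\<rbrakk> \<Longrightarrow> r = \<zero>\<^bsub>A\<^esub>"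
  shows "\<exists>h \<in> algebra_iso R S (T_algebra R A a b). h q = Q_mat A a b \<and> h x = X_mat A a"
proof -
  interpret A: assoc_algebra R A by (rule A)
  let ?T = "T_algebra R A a b" and ?g = "case_gen_qx (Q_mat A a b) (X_mat A a)"
  have T: "assoc_algebra R ?T" using ab by (rule A.T_algebra_assoc_algebra)
  have g: "?g i \<in> carrier ?T" for i
    using A.Q_mat_closed[OF ab] A.X_mat_closed[OF ab] by (cases i) simp_all
  have "free_eval R ?T ?g p = \<zero>\<^bsub>?T\<^esub>" if "p \<in> S_rels R" for p
    using T g _ _ that by (rule S_rels_eval)
      (simp_all add: A.T_algebra_simps[OF ab] A.QX_relations[OF ab])
  with zero have *: "free_eval R ?T ?g p = \<zero>\<^bsub>?T\<^esub>" if "p \<in> rels" for p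
    using that by blast
  obtain h where h: "h \<in> algebra_hom R S ?T" "\<And>i. h (presented_gen R rels i) = ?g i"
    by (rule presented_algebra_lift[OF rels(2) T g *, folded S_def], assumption, rule that)
  note facts = presented_algebra_facts[OF rels(2), folded S_def]
  interpret S: assoc_algebra R S by (rule facts(1))
  note rel = S_rels_presented[OF rels, folded S_def q_def x_def]
  have qx: "q \<in> carrier S" "x \<in> carrier S" using facts(6) by (simp_all add: q_def x_def)
  have genS: "generates R S {q, x}"
    using facts(7) by (simp add: UNIV_gen_qx q_def x_def)
  interpret corner_hom R S A q x a b \<phi>
    by (intro corner_hom.intro corner_hom_axioms.intro S.assoc_algebra_axioms A)
      (use qx ab rel phi gen genS in \<open>simp_all add: S.m_assoc\<close>)
  have "h \<in> algebra_iso R S ?T"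
  proof (rule iso_T_algebra)
    show "c = \<zero>" if "c \<in> carrier R" "r \<in> carrier A"
      "c \<odot>\<^bsub>A\<^esub> \<one>\<^bsub>A\<^esub> \<oplus>\<^bsub>A\<^esub> r \<otimes>\<^bsub>A\<^esub> (\<one>\<^bsub>A\<^esub> \<ominus>\<^bsub>A\<^esub> b \<otimes>\<^bsub>A\<^esub> a) = \<zero>\<^bsub>A\<^esub>" for c r
      using A ab \<rho> that by (rule scalar_not_in_I)
  qed (use h cancel in \<open>simp_all add: q_def x_def\<close>)
  moreover have "h q = Q_mat A a b" "h x = X_mat A a"
    using h(2)[of Gen_q] h(2)[of Gen_x] by (simp_all add: q_def x_def)
  ultimately show ?thesis by blast
qed

lemma (in assoc_algebra) corner_gen_closed:
  assumes "q \<in> carrier A" "x \<in> carrier A" "q \<otimes> x \<otimes> q = q" "x \<otimes> q \<otimes> x = x"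
  shows "assoc_algebra F (corner A (q \<otimes> x))"
    and "q \<otimes> (x \<otimes> x) \<in> carrier (corner A (q \<otimes> x))"
    and "q \<otimes> (q \<otimes> x) \<in> carrier (corner A (q \<otimes> x))"
proof -
  have x: "x \<otimes> (q \<otimes> x) = x" and xl: "x \<otimes> (q \<otimes> (x \<otimes> u)) = x \<otimes> u" if "u \<in> carrier A" for u
    using assms that by (simp_all flip: m_assoc)
  have q: "q \<otimes> (x \<otimes> (q \<otimes> u)) = q \<otimes> u" if "u \<in> carrier A" for u
    using assms that by (simp flip: m_assoc)
  show "assoc_algebra F (corner A (q \<otimes> x))"
    using assms(1,2) x[OF assms(1)] by (intro corner_assoc_algebra) (simp_all add: m_assoc)
  show "q \<otimes> (x \<otimes> x) \<in> carrier (corner A (q \<otimes> x))" "q \<otimes> (q \<otimes> x) \<in> carrier (corner A (q \<otimes> x))"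
    using assms(1,2) x[OF assms(1)] by (simp_all add: m_assoc q xl)
qed

text \<open>Between consecutive factors x q x collapses to x, so each factor adds one
  \<open>x\<close>. At k = 0 both sides are q x, the unit of the corner. Consequently x^n = 0 forces
  the (n-1)-st power of q x x to vanish.\<close>

lemma (in assoc_algebra) corner_pow:
  assumes "q \<in> carrier A" "x \<in> carrier A" "x \<otimes> q \<otimes> x = x"
  shows "(q \<otimes> (x \<otimes> x)) [^]\<^bsub>corner A (q \<otimes> x)\<^esub> (k::nat) = q \<otimes> x [^] Suc k"
proof (induction k)
  case 0
  show ?case using assms by simp
next
  case (Suc k)
  have x: "x \<otimes> (q \<otimes> (x \<otimes> u)) = x \<otimes> u" if "u \<in> carrier A" for u
    using assms that by (simp flip: m_assoc)
  show ?case using Suc assms by (simp add: m_assoc x)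
qed

lemma (in cring) presented_pow_zero:
  assumes rels: "rels \<subseteq> carrier (free_algebra R)"
    and mem: "free_gen R i [^]\<^bsub>free_algebra R\<^esub> (k::nat) \<in> rels"
  shows "presented_gen R rels i [^]\<^bsub>presented_algebra R rels\<^esub> k = \<zero>\<^bsub>presented_algebra R rels\<^esub>"
proof -
  interpret free: assoc_algebra R "free_algebra R" by (rule free_algebra_assoc_algebra)
  note facts = presented_algebra_facts[OF rels]
  let ?\<pi> = "\<lambda>p. (Idl\<^bsub>free_algebra R\<^esub> rels) +>\<^bsub>free_algebra R\<^esub> p"
  let ?p = "free_gen R i [^]\<^bsub>free_algebra R\<^esub> k"
  have "?\<pi> ?p = presented_gen R rels i [^]\<^bsub>presented_algebra R rels\<^esub> k"
    using algebra_hom_pow[OF free.assoc_algebra_axioms facts(2) free_gen_closed]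
    unfolding facts(5) .
  moreover have "?\<pi> ?p = \<zero>\<^bsub>presented_algebra R rels\<^esub>"
    using facts(4) free.genideal_self[OF rels] mem rels by blast
  ultimately show ?thesis by simp
qed

theorem proposition3p1:
  fixes F :: "('f, 'm) ring_scheme"
  assumes "field F"
  shows
    "(let R = free_algebra F; a = free_gen F Gen_a; b = free_gen F Gen_b;
          rS = S_rels F; S = presented_algebra F rS;
          q = presented_gen F rS Gen_q; x = presented_gen F rS Gen_x
      in \<exists>h \<in> algebra_iso F S (T_algebra F R a b). h q = Q_mat R a b \<and> h x = X_mat R a)
   \<and> (\<forall>n::nat. n \<ge> 3 \<longrightarrow>
       (let rR = R_nil_rels F n; R = presented_algebra F rR;
            a = presented_gen F rR Gen_a; b = presented_gen F rR Gen_b;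
            rS = S_nil_rels F n; S = presented_algebra F rS;
            q = presented_gen F rS Gen_q; x = presented_gen F rS Gen_x
        in \<exists>h \<in> algebra_iso F S (T_algebra F R a b). h q = Q_mat R a b \<and> h x = X_mat R a))"
proof -
  interpret F: field F by fact
  interpret free: assoc_algebra F "free_algebra F" by (rule F.free_algebra_assoc_algebra)
  interpret K: assoc_algebra F "scalar_algebra F" by (rule F.scalar_algebra_assoc_algebra)
  let ?M = "mat2_algebra (scalar_algebra F)"
  interpret M: assoc_algebra F ?M by (rule K.mat2_assoc_algebra)
  let ?E = "case_gen_ab (Mat2 \<zero>\<^bsub>F\<^esub> \<zero>\<^bsub>F\<^esub> \<one>\<^bsub>F\<^esub> \<zero>\<^bsub>F\<^esub>) (Mat2 \<zero>\<^bsub>F\<^esub> \<one>\<^bsub>F\<^esub> \<zero>\<^bsub>F\<^esub> \<zero>\<^bsub>F\<^esub>)"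
  have E: "?E i \<in> carrier ?M" for i by (cases i) simp_all
  note evalE = M.free_eval_hom[of ?E, OF E]
  \<comment> \<open>With e = q x, the images of \<open>a\<close> and \<open>b\<close> are e x = e x
    e and q e = e q e, the corner components of \<open>x\<close> and \<open>q\<close>.\<close>
  let ?g = "\<lambda>S q x. case_gen_ab (q \<otimes>\<^bsub>S\<^esub> (x \<otimes>\<^bsub>S\<^esub> x)) (q \<otimes>\<^bsub>S\<^esub> (q \<otimes>\<^bsub>S\<^esub> x))"
  show ?thesis
    unfolding Let_def
  proof (intro conjI allI impI)
    let ?S = "presented_algebra F (S_rels F)"
    let ?q = "presented_gen F (S_rels F) Gen_q" and ?x = "presented_gen F (S_rels F) Gen_x"
    let ?A = "free_algebra F" and ?a = "free_gen F Gen_a" and ?b = "free_gen F Gen_b"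
    note rel = F.S_rels_presented[OF subset_refl F.S_rels_closed]
    note facts = F.presented_algebra_facts[OF F.S_rels_closed]
    interpret S: assoc_algebra F ?S by (rule facts(1))
    note corner = S.corner_gen_closed[OF facts(6) facts(6) rel]
    have g: "?g ?S ?q ?x i \<in> carrier (corner ?S (?q \<otimes>\<^bsub>?S\<^esub> ?x))" for i
      using corner(2,3) by (cases i) (simp_all only: gen_ab.case)
    note eval = assoc_algebra.free_eval_hom[OF corner(1), of "?g ?S ?q ?x", OF g]
    have "generates F (free_algebra F) (range (free_gen F) :: (gen_ab list \<Rightarrow> 'f) set)"
      by (rule F.free_algebra_generates)
    then have "generates F (free_algebra F) {?a, ?b}"
      by (simp add: UNIV_gen_ab)
    then show "\<exists>h \<in> algebra_iso F ?S (T_algebra F (free_algebra F) ?a ?b).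
        h ?q = Q_mat (free_algebra F) ?a ?b \<and> h ?x = X_mat (free_algebra F) ?a"
    \<comment> \<open>For the free algebra \<open>\<phi>\<close> and \<open>\<rho>\<close> are
      evaluations outright, and there are no extra relations to check on the matrices.\<close>
    proof (rule F.presented_iso_T_algebra[OF subset_refl F.S_rels_closed free.assoc_algebra_axioms
          F.free_gen_closed F.free_gen_closed _ _ eval(1) _ _ evalE(1)])
      show "r = \<zero>\<^bsub>?A\<^esub>" if "r \<in> carrier ?A"
        "r \<otimes>\<^bsub>?A\<^esub> (\<one>\<^bsub>?A\<^esub> \<ominus>\<^bsub>?A\<^esub> ?b \<otimes>\<^bsub>?A\<^esub> ?a) = \<zero>\<^bsub>?A\<^esub>" for r
        using that by (rule F.free_algebra_cancel)
    qed (simp_all add: eval(2) evalE(2))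
  next
    fix n :: nat assume "n \<ge> 3"
    \<comment> \<open>In terms of \<open>k\<close> the exponents n and n - 1 are successors, k + 3
      and k + 2, so the power lemmas apply.\<close>
    define k where "k = n - 3"
    with \<open>n \<ge> 3\<close> have n: "n = Suc (Suc (Suc k))" by simp
    let ?rR = "R_nil_rels F n" and ?rS = "S_nil_rels F n"
    let ?R = "presented_algebra F ?rR" and ?S = "presented_algebra F ?rS"
    let ?q = "presented_gen F ?rS Gen_q" and ?x = "presented_gen F ?rS Gen_x"
    let ?a = "presented_gen F ?rR Gen_a" and ?b = "presented_gen F ?rR Gen_b"
    have subR: "?rR \<subseteq> carrier (free_algebra F)" by (simp add: R_nil_rels_def)
    have subS: "S_rels F \<subseteq> ?rS" "?rS \<subseteq> carrier (free_algebra F)"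
      using F.S_rels_closed by (auto simp: S_nil_rels_def)
    note rel = F.S_rels_presented[OF subS]
    note factsR = F.presented_algebra_facts[OF subR]
    note factsS = F.presented_algebra_facts[OF subS(2)]
    interpret R: assoc_algebra F ?R by (rule factsR(1))
    interpret S: assoc_algebra F ?S by (rule factsS(1))
    interpret T: assoc_algebra F "T_algebra F ?R ?a ?b"
      by (rule R.T_algebra_assoc_algebra) (rule factsR(6))+
    have a_pow: "?a [^]\<^bsub>?R\<^esub> Suc (Suc k) = \<zero>\<^bsub>?R\<^esub>"
      using subR by (rule F.presented_pow_zero) (simp add: R_nil_rels_def n)
    have x_pow: "?x [^]\<^bsub>?S\<^esub> Suc (Suc (Suc k)) = \<zero>\<^bsub>?S\<^esub>"
      using subS(2) by (rule F.presented_pow_zero) (simp add: S_nil_rels_def n)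
    have gen: "generates F ?R {?a, ?b}"
      using factsR(7) by (simp add: UNIV_gen_ab)
    note corner = S.corner_gen_closed[OF factsS(6) factsS(6) rel]
    let ?C = "corner ?S (?q \<otimes>\<^bsub>?S\<^esub> ?x)"
    have g: "?g ?S ?q ?x i \<in> carrier ?C" for i
      using corner(2,3) by (cases i) (simp_all only: gen_ab.case)
    note evalC = assoc_algebra.free_eval_hom[OF corner(1), of "?g ?S ?q ?x", OF g]
    \<comment> \<open>The relation a^(n-1) = 0 holds in the corner because (q x x)^(n-1) = q x^n =
      0.\<close>
    have phi_zero: "free_eval F ?C (?g ?S ?q ?x) p = \<zero>\<^bsub>?C\<^esub>" if "p \<in> ?rR" for p
    proof -
      have "p = free_gen F Gen_a [^]\<^bsub>free_algebra F\<^esub> Suc (Suc k)"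
        using that by (simp add: R_nil_rels_def n)
      then have "free_eval F ?C (?g ?S ?q ?x) p = (?q \<otimes>\<^bsub>?S\<^esub> (?x \<otimes>\<^bsub>?S\<^esub> ?x)) [^]\<^bsub>?C\<^esub> Suc (Suc k)"
        using algebra_hom_pow[OF free.assoc_algebra_axioms evalC(1) F.free_gen_closed[of Gen_a]]
        by (simp only: evalC(2) gen_ab.case)
      also have "\<dots> = \<zero>\<^bsub>?C\<^esub>"
        using factsS(6) by (simp only: S.corner_pow[OF factsS(6) factsS(6) rel(2)] x_pow S.r_null corner_simps)
      finally show ?thesis .
    qed
    obtain \<phi> where \<phi>: "\<phi> \<in> algebra_hom F ?R ?C" "\<And>i. \<phi> (presented_gen F ?rR i) = ?g ?S ?q ?x i"
      by (rule F.presented_algebra_lift[OF subR corner(1) g phi_zero], assumption, rule that)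
    \<comment> \<open>E21 squares to zero, and n - 1 = k + 2 leaves at least two factors.\<close>
    have rho_zero: "free_eval F ?M ?E p = \<zero>\<^bsub>?M\<^esub>" if "p \<in> ?rR" for p
    proof -
      have "p = free_gen F Gen_a [^]\<^bsub>free_algebra F\<^esub> Suc (Suc k)"
        using that by (simp add: R_nil_rels_def n)
      then have "free_eval F ?M ?E p = ?E Gen_a [^]\<^bsub>?M\<^esub> Suc (Suc k)"
        using algebra_hom_pow[OF free.assoc_algebra_axioms evalE(1) F.free_gen_closed[of Gen_a]]
        by (simp only: evalE(2))
      also have "\<dots> = ?E Gen_a [^]\<^bsub>?M\<^esub> k \<otimes>\<^bsub>?M\<^esub> (?E Gen_a \<otimes>\<^bsub>?M\<^esub> ?E Gen_a)"
        using M.m_assoc[OF M.nat_pow_closed[OF E] E E] by (simp only: M.nat_pow_Suc)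
      also have "?E Gen_a \<otimes>\<^bsub>?M\<^esub> ?E Gen_a = \<zero>\<^bsub>?M\<^esub>" by simp
      finally show ?thesis using M.r_null[OF M.nat_pow_closed[OF E]] by metis
    qed
    obtain \<rho> where \<rho>: "\<rho> \<in> algebra_hom F ?R ?M" "\<And>i. \<rho> (presented_gen F ?rR i) = ?E i"
      by (rule F.presented_algebra_lift[OF subR M.assoc_algebra_axioms E rho_zero], assumption, rule that)
    let ?T = "T_algebra F ?R ?a ?b" and ?QX = "case_gen_qx (Q_mat ?R ?a ?b) (X_mat ?R ?a)"
    have QX: "?QX i \<in> carrier ?T" for i
      using R.Q_mat_closed[OF factsR(6) factsR(6)] R.X_mat_closed[OF factsR(6) factsR(6)]
      by (cases i) (simp_all only: gen_qx.case)
    note evalT = T.free_eval_hom[of ?QX, OF QX]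
    \<comment> \<open>The only possible extra relation is x^n. The nonzero entries of X^n could only
      be a^n and a^(n-1), and both vanish in this \<open>R\<close>.\<close>
    have zero: "free_eval F ?T ?QX p = \<zero>\<^bsub>?T\<^esub>" if "p \<in> ?rS - S_rels F" for p
    proof -
      have "p = free_gen F Gen_x [^]\<^bsub>free_algebra F\<^esub> Suc (Suc (Suc k))"
        using that by (auto simp: S_nil_rels_def n)
      then have "free_eval F ?T ?QX p = X_mat ?R ?a [^]\<^bsub>?T\<^esub> Suc (Suc (Suc k))"
        using algebra_hom_pow[OF free.assoc_algebra_axioms evalT(1) F.free_gen_closed[of Gen_x]]
        by (simp only: evalT(2) gen_qx.case)
      also have "\<dots> = \<zero>\<^bsub>?T\<^esub>"
        using a_pow factsR(6)[of Gen_a]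
        by (simp only: R.X_mat_pow[OF factsR(6) factsR(6)] R.T_algebra_simps[OF factsR(6) factsR(6)]
          R.nat_pow_Suc[of _ "Suc (Suc k)"] R.l_null R.mat2_simps)
      finally show ?thesis .
    qed
    show "\<exists>h \<in> algebra_iso F ?S ?T. h ?q = Q_mat ?R ?a ?b \<and> h ?x = X_mat ?R ?a"
    proof (rule F.presented_iso_T_algebra[OF subS factsR(1) factsR(6) factsR(6) gen zero \<phi>(1) _ _ \<rho>(1)])
      show "r = \<zero>\<^bsub>?R\<^esub>" if "r \<in> carrier ?R"
        "r \<otimes>\<^bsub>?R\<^esub> (\<one>\<^bsub>?R\<^esub> \<ominus>\<^bsub>?R\<^esub> ?b \<otimes>\<^bsub>?R\<^esub> ?a) = \<zero>\<^bsub>?R\<^esub>" for r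
        using that unfolding R_nil_rels_def by (rule F.nil_algebra_cancel)
    qed (simp_all add: \<phi>(2) \<rho>(2))
  qed
qed

end
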